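(* Let $X$ be a proper geodesic metric space with a convergence boundary $\partial X$, let $\Gamma<\mathrm{Isom}(X)$ be a non-elementary discrete subgroup with non-pinched contracting elements such that $\Gamma\curvearrowright X$ is of divergence type, and let $H<\mathrm{Isom}(X)$ be a discrete subgroup confined by $\Gamma$ with a finite confining subset $P$ that intersects $E(\Gamma)$ trivially. Let $\{\mu_x\}_{x\in X}$ be an $\omega_H$-dimensional $H$-quasi-equivariant quasi-conformal density (with constant $\lambda$) supported on $\partial X$. Then there exists $r_0>0$ such that $$\|\mu_y\|e^{-\omega_H d(x,y)}\ \prec_\lambda\ \mu_x(\Pi_x(y,r))\ \prec_{\lambda,\epsilon,r}\ \|\mu_y\|e^{-\omega_H d(x,y)}$$ for any $x,y\in\Gamma o$ and $r\ge r_0$.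
   Context: Fix $o\in X$. $f\prec_{c_1,c_2,\dots}g$ means $f<Cg$ with $C>0$ depending on the parameters $c_i$ (and the fixed data $X,\Gamma,H,P$), not on $x,y$. $\|\mu\|$ is total mass. Shadows: $\Omega_x(y,r)=\{z\in X:\text{some geodesic }[x,z]\text{ meets }B(y,r)\}$, and $\Pi_x(y,r)\subseteq\partial X$ is its topological closure in $\partial X$ (its set of accumulation points in $\partial X$). Contracting: a closed $Z\subseteq X$ is $C$-contracting if $\mathrm{diam}(\pi_Z(x)\cup\pi_Z(y))\le C$ whenever $d(x,y)\le d(x,Z)$, where $\pi_Z$ is the nearest-point projection (set). An isometry $g$ is contracting if $n\mapsto g^no$ is a quasi-isometric embedding of $\mathbb Z$ with contracting image. A group is elementary if finite or virtually $\mathbb Z$. $\omega_H=\limsup_n\frac1n\log\sharp\{ho:h\in H,d(o,ho)\le n\}$. Divergence type: $\sum_{g\in\Gamma}e^{-\omega_\Gamma d(o,go)}=\infty$. Confined with finite confining subset $P\subseteq\mathrm{Isom}(X)$: $g^{-1}Hg\cap(P\setminus\{1\})\ne\emptyset$ for all $g\in\Gamma$. "Intersects $E(\Gamma)$ trivially" means $P\cap E(\Gamma)\subseteq\{1\}$. Convergence boundary: a metrizable compactification $\overline X=X\cup\partial X$ with $X$ open and dense, to which the action of $\mathrm{Isom}(X)$ extends by homeomorphisms, with an $\mathrm{Isom}(X)$-invariant partition $[\cdot]$ of $\partial X$ ($[\xi]$ is the class of $\xi$; $[A]=\bigcup_{\xi\in A}[\xi]$). A sequence tends (accumulates) to $[\xi]$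 if its limit (all its accumulation points) lie in $[\xi]$; subsets or points $A_n$ are escaping if $d(o,A_n)\to\infty$. Required: (A) any contracting geodesic ray $\gamma$ accumulates into a closed class $[\xi]$, and any $y_n\in X$ with $\pi_\gamma(y_n)$ escaping tends to $[\xi]$. (B) for any escaping sequence of $C$-contracting quasi-geodesics $X_n$ ($C$ fixed), and any $o$, some subsequence of the cones $\Omega_o(X_n)=\{y\in X:\text{some geodesic }[o,y]\text{ meets }X_n\}$ accumulates to a class $[\xi]$, i.e. any convergent sequence $y_n\in\Omega_o(X_n)$ tends to a point of $[\xi]$. (C) the set $\mathcal C$ of non-pinched points is nonempty, where $\xi$ is non-pinched if for all sequences $x_n,y_n\in X$ converging to $[\xi]$ the segments $[x_n,y_n]$ are escaping; and for $\xi\in\mathcal C$, $[\cdot]$ is closed on $U=\Gamma[\xi]$: if $x_n,y_n\in U$, $[x_n]=[y_n]$, $x_n\to\xi'$, $y_n\to\eta'$, then $[\xi']=[\eta']$. By (A) the rays $n\mapsto f^{\pm n}o$, $n\geq 0$, of a contracting element $f$ determine classes $[f^+],[f^-]$; $f$ is non-pinched if $[f^+]\cup[f^-]\subseteq\mathcal C$. $E(\Gamma)=\{g\in\mathrm{Isom}(X): g[\xi]=[\xi]\text{ for every class }[\xi]\subseteq[\Lambda(\Gamma o)]\}$, where $\Lambda(\Gamma o)$ is the set of accumulation points of $\Gamma o$ in $\partial X$. Busemann quasi-cocycles: it is assumed that there is $\mathcal C^{\mathrm{hor}}\subseteq\mathcal C$ and functions $B_\xi:X\times X\to\mathbb R$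 ($\xi\in\mathcal C^{\mathrm{hor}}$) with $\limsup_{z\to[\xi]}|B_\xi(x,y)-(d(x,z)-d(y,z))|\le\epsilon$ for all $x,y\in X$; $\epsilon$ in the lemma is this convergence error (on the points charged by the density). $\omega$-dimensional $H$-quasi-equivariant quasi-conformal density with constant $\lambda\ge1$: finite positive Radon measures $\mu_x$ ($x\in X$) with $\frac{dh_\star\mu_x}{d\mu_{hx}}(\xi)\in[\lambda^{-1},\lambda]$ for $\mu_{hx}$-a.e. $\xi$ and all $h\in H$, and $\lambda^{-1}e^{-\omega B_\xi(x,y)}\le\frac{d\mu_x}{d\mu_y}(\xi)\le\lambda e^{-\omega B_\xi(x,y)}$ for $\mu_y$-a.e. $\xi$ and all $x,y$; normalized by $\|\mu_o\|=1$.
   Formalization: The constant in the lower bound may depend, besides λ and X, Γ, H, P, on the Busemann quasi-cocycles and their error ε; a constant depending on λ alone, uniform in the cocycles, does not exist (rescale the density by a bounded H-invariant function). *)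

theory Defs
  imports "HOL-Analysis.Analysis" "HOL-Algebra.Elementary_Groups"
begin

text \<open>The proper metric space \<open>X\<close> is a type of class \<open>heine_borel\<close>.  Its compactification is a
  second metric type, into which \<open>X\<close> is mapped by \<open>emb\<close>; only the topology of the second type is
  used.  The basepoint of \<open>X\<close> is written \<open>bp\<close>.\<close>

section \<open>Isometries and their groups\<close>

definition isometries :: "('a::metric_space \<Rightarrow> 'a) set" where
  "isometries = {g. surj g \<and> (\<forall>x y. dist (g x) (g y) = dist x y)}"

definition isom_group :: "('a::metric_space \<Rightarrow> 'a) monoid" where
  "isom_group = \<lparr>carrier = isometries, monoid.mult = (\<circ>), one = id\<rparr>"

lemma group_isom_group: "group (isom_group :: ('a::metric_space \<Rightarrow> 'a) monoid)"
proof (rule groupI)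
  fix g :: "'a \<Rightarrow> 'a" assume "g \<in> carrier isom_group"
  then have g: "surj g" "\<And>x y. dist (g x) (g y) = dist x y"
    by (auto simp: isom_group_def isometries_def)
  have "inj g" by (rule injI) (metis g(2) dist_eq_0_iff)
  have l: "g (inv_into UNIV g x) = x" for x using g(1) by (rule surj_f_inv_f)
  have "inv_into UNIV g \<in> isometries"
    using g(2)[of "inv_into UNIV g x" "inv_into UNIV g y" for x y] inj_imp_surj_inv[OF \<open>inj g\<close>]
    by (simp add: isometries_def l)
  moreover have "inv_into UNIV g \<circ> g = id" using \<open>inj g\<close> by simp
  ultimately show "\<exists>h \<in> carrier isom_group. h \<otimes>\<^bsub>isom_group\<^esub> g = \<one>\<^bsub>isom_group\<^esub>"
    by (auto simp: isom_group_def)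
next
  fix g h :: "'a \<Rightarrow> 'a" assume "g \<in> carrier isom_group" "h \<in> carrier isom_group"
  then show "g \<otimes>\<^bsub>isom_group\<^esub> h \<in> carrier isom_group"
    using comp_surj[of h g] by (simp add: isom_group_def isometries_def)
qed (auto simp: isom_group_def isometries_def fun_eq_iff)

definition elementary_group :: "('g, 'm) monoid_scheme \<Rightarrow> bool" where
  "elementary_group G \<longleftrightarrow> finite (carrier G) \<or>
     (\<exists>K. subgroup K G \<and> finite (rcosets\<^bsub>G\<^esub> K) \<and> G\<lparr>carrier := K\<rparr> \<cong> integer_group)"

definition growth_rate :: "'a::metric_space \<Rightarrow> ('a \<Rightarrow> 'a) set \<Rightarrow> ereal" where
  "growth_rate bp H =
     limsup (\<lambda>n. ereal (ln (real (card {h bp |h. h \<in> H \<and> dist bp (h bp) \<le> real n})) / real n))"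

text \<open>If the growth rate is infinite, then all but finitely many terms of the Poincare series of a
  discrete group vanish, so divergence forces it to be finite.\<close>

definition divergence_type :: "'a::metric_space \<Rightarrow> ('a \<Rightarrow> 'a) set \<Rightarrow> bool" where
  "divergence_type bp \<Gamma> \<longleftrightarrow> growth_rate bp \<Gamma> < \<infinity> \<and>
     \<not> (\<lambda>g. exp (- real_of_ereal (growth_rate bp \<Gamma>) * dist bp (g bp))) summable_on \<Gamma>"

definition confining_subset ::
  "('a::metric_space \<Rightarrow> 'a) set \<Rightarrow> ('a \<Rightarrow> 'a) set \<Rightarrow> ('a \<Rightarrow> 'a) set \<Rightarrow> bool" where
  "confining_subset \<Gamma> H P \<longleftrightarrow> finite P \<and> P \<subseteq> isometries \<and>
     (\<forall>g\<in>\<Gamma>. {inv\<^bsub>isom_group\<^esub> g \<circ> h \<circ> g |h. h \<in> H} \<inter> (P - {id}) \<noteq> {})"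

section \<open>Geodesics and contracting sets\<close>

definition geodesic_segment :: "'a::metric_space \<Rightarrow> 'a \<Rightarrow> 'a set \<Rightarrow> bool" where
  "geodesic_segment x y S \<longleftrightarrow> (\<exists>\<gamma>. \<gamma> 0 = x \<and> \<gamma> (dist x y) = y \<and>
     (\<forall>s\<in>{0..dist x y}. \<forall>t\<in>{0..dist x y}. dist (\<gamma> s) (\<gamma> t) = \<bar>s - t\<bar>) \<and>
     S = \<gamma> ` {0..dist x y})"

definition geodesic_ray :: "(real \<Rightarrow> 'a::metric_space) \<Rightarrow> bool" where
  "geodesic_ray \<gamma> \<longleftrightarrow> (\<forall>s\<ge>0. \<forall>t\<ge>0. dist (\<gamma> s) (\<gamma> t) = \<bar>s - t\<bar>)"

definition qi_embedding_on :: "'m::metric_space set \<Rightarrow> ('m \<Rightarrow> 'a::metric_space) \<Rightarrow> bool" where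
  "qi_embedding_on S f \<longleftrightarrow> (\<exists>c\<ge>1. \<forall>s\<in>S. \<forall>t\<in>S.
     dist s t / c - c \<le> dist (f s) (f t) \<and> dist (f s) (f t) \<le> c * dist s t + c)"

definition quasi_geodesic :: "'a::metric_space set \<Rightarrow> bool" where
  "quasi_geodesic Z \<longleftrightarrow>
     (\<exists>(I :: real set) p. is_interval I \<and> I \<noteq> {} \<and> qi_embedding_on I p \<and> Z = p ` I)"

definition nearest_pts :: "'a::metric_space set \<Rightarrow> 'a \<Rightarrow> 'a set" where
  "nearest_pts Z x = {z \<in> Z. dist x z = infdist x Z}"

definition contracting :: "real \<Rightarrow> 'a::metric_space set \<Rightarrow> bool" where
  "contracting C Z \<longleftrightarrow> closed Z \<and>
     (\<forall>x y. dist x y \<le> infdist x Z \<longrightarrow> diameter (nearest_pts Z x \<union> nearest_pts Z y) \<le> C)"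

text \<open>\<open>\<int>\<close> is the set of integers inside the reals, on which \<open>\<lfloor>t\<rfloor>\<close> is the integer \<open>t\<close>.\<close>

definition contracting_isometry :: "'a::metric_space \<Rightarrow> ('a \<Rightarrow> 'a) \<Rightarrow> bool" where
  "contracting_isometry bp g \<longleftrightarrow> g \<in> isometries \<and>
     qi_embedding_on \<int> (\<lambda>t::real. (g [^]\<^bsub>isom_group\<^esub> \<lfloor>t\<rfloor>) bp) \<and>
     (\<exists>C. contracting C (range (\<lambda>n::int. (g [^]\<^bsub>isom_group\<^esub> n) bp)))"

text \<open>This is only used for sequences of nonempty sets (\<open>infdist x {} = 0\<close>).\<close>

definition escaping :: "'a::metric_space \<Rightarrow> (nat \<Rightarrow> 'a set) \<Rightarrow> bool" where
  "escaping bp A \<longleftrightarrow> filterlim (\<lambda>n. infdist bp (A n)) at_top sequentially"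

definition cone :: "'a::metric_space \<Rightarrow> 'a set \<Rightarrow> 'a set" where
  "cone x A = {z. \<exists>S. geodesic_segment x z S \<and> S \<inter> A \<noteq> {}}"

section \<open>Convergence boundaries\<close>

definition bdry :: "('a \<Rightarrow> 'b) \<Rightarrow> 'b set" where
  "bdry emb = - range emb"

definition limit_set :: "('a \<Rightarrow> 'b::metric_space) \<Rightarrow> 'a set \<Rightarrow> 'b set" where
  "limit_set emb A = closure (emb ` A) \<inter> bdry emb"

text \<open>The boundary shadow \<open>\<Pi>\<^sub>x(y,r)\<close>.\<close>

definition shadow :: "('a::metric_space \<Rightarrow> 'b::metric_space) \<Rightarrow> 'a \<Rightarrow> 'a \<Rightarrow> real \<Rightarrow> 'b set" where
  "shadow emb x y r = limit_set emb (cone x (ball y r))"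

definition acc_points :: "('a \<Rightarrow> 'b::metric_space) \<Rightarrow> (nat \<Rightarrow> 'a) \<Rightarrow> 'b set" where
  "acc_points emb y =
     {\<zeta>. \<exists>s::nat \<Rightarrow> nat. strict_mono s \<and> (\<lambda>n. emb (y (s n))) \<longlonglongrightarrow> \<zeta>}"

text \<open>The partition of the boundary is given by an equivalence relation \<open>R\<close>; the class of \<open>\<xi>\<close> is
  \<open>R `` {\<xi>}\<close>, and \<open>[A]\<close> is \<open>R `` A\<close>.  A sequence that tends to a class need not converge: all
  its accumulation points in the compactification are required to lie in the class.\<close>

definition tends_to_class ::
  "('a \<Rightarrow> 'b::metric_space) \<Rightarrow> ('b \<times> 'b) set \<Rightarrow> (nat \<Rightarrow> 'a) \<Rightarrow> 'b \<Rightarrow> bool" where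
  "tends_to_class emb R y \<xi> \<longleftrightarrow> acc_points emb y \<subseteq> R `` {\<xi>}"

definition nonpinched_points ::
  "'a::metric_space \<Rightarrow> ('a \<Rightarrow> 'b::metric_space) \<Rightarrow> ('b \<times> 'b) set \<Rightarrow> 'b set" where
  "nonpinched_points bp emb R = {\<xi> \<in> bdry emb. \<forall>x y S.
     tends_to_class emb R x \<xi> \<and> tends_to_class emb R y \<xi> \<and>
     (\<forall>n. geodesic_segment (x n) (y n) (S n)) \<longrightarrow> escaping bp S}"

definition compactification :: "('a::metric_space \<Rightarrow> 'b::metric_space) \<Rightarrow> bool" where
  "compactification emb \<longleftrightarrow> compact (UNIV :: 'b set) \<and> embedding_map euclidean euclidean emb \<and>
     open (range emb) \<and> closure (range emb) = UNIV"

definition extends_action ::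
  "('a::metric_space \<Rightarrow> 'b::metric_space) \<Rightarrow> (('a \<Rightarrow> 'a) \<Rightarrow> 'b \<Rightarrow> 'b) \<Rightarrow> bool" where
  "extends_action emb act \<longleftrightarrow> (\<forall>g\<in>isometries.
     homeomorphic_map euclidean euclidean (act g) \<and> (\<forall>x. act g (emb x) = emb (g x)))"

text \<open>The three assumptions (A), (B), (C) on the partition.\<close>

definition rays_converge ::
  "'a::metric_space \<Rightarrow> ('a \<Rightarrow> 'b::metric_space) \<Rightarrow> ('b \<times> 'b) set \<Rightarrow> bool" where
  "rays_converge bp emb R \<longleftrightarrow>
     (\<forall>\<gamma>. geodesic_ray \<gamma> \<and> (\<exists>C. contracting C (\<gamma> ` {0..})) \<longrightarrow>
       (\<exists>\<xi>\<in>bdry emb. closed (R `` {\<xi>}) \<and>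
         (\<forall>t::nat \<Rightarrow> real. filterlim t at_top sequentially \<longrightarrow>
            tends_to_class emb R (\<lambda>n. \<gamma> (t n)) \<xi>) \<and>
         (\<forall>y. escaping bp (\<lambda>n. nearest_pts (\<gamma> ` {0..}) (y n)) \<longrightarrow> tends_to_class emb R y \<xi>)))"

definition cones_converge ::
  "'a::metric_space \<Rightarrow> ('a \<Rightarrow> 'b::metric_space) \<Rightarrow> ('b \<times> 'b) set \<Rightarrow> bool" where
  "cones_converge bp emb R \<longleftrightarrow>
     (\<forall>C Z x. (\<forall>n. quasi_geodesic (Z n) \<and> contracting C (Z n)) \<and> escaping bp Z \<longrightarrow>
       (\<exists>s::nat \<Rightarrow> nat. strict_mono s \<and> (\<exists>\<xi>\<in>bdry emb. \<forall>y \<zeta>.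
          (\<forall>n. y n \<in> cone x (Z (s n))) \<and> (\<lambda>n. emb (y n)) \<longlonglongrightarrow> \<zeta> \<longrightarrow> \<zeta> \<in> R `` {\<xi>})))"

definition partition_closed_on :: "('b::metric_space \<times> 'b) set \<Rightarrow> 'b set \<Rightarrow> bool" where
  "partition_closed_on R U \<longleftrightarrow> (\<forall>(x::nat \<Rightarrow> 'b) y \<xi> \<eta>.
     (\<forall>n. x n \<in> U \<and> y n \<in> U \<and> (x n, y n) \<in> R) \<and> x \<longlonglongrightarrow> \<xi> \<and> y \<longlonglongrightarrow> \<eta> \<longrightarrow> (\<xi>, \<eta>) \<in> R)"

definition convergence_boundary ::
  "'a::metric_space \<Rightarrow> ('a \<Rightarrow> 'b::metric_space) \<Rightarrow> (('a \<Rightarrow> 'a) \<Rightarrow> 'b \<Rightarrow> 'b) \<Rightarrow> ('b \<times> 'b) set \<Rightarrow>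
   ('a \<Rightarrow> 'a) set \<Rightarrow> bool" where
  "convergence_boundary bp emb act R \<Gamma> \<longleftrightarrow>
     compactification emb \<and> extends_action emb act \<and>
     equiv (bdry emb) R \<and> (\<forall>g\<in>isometries. \<forall>(\<xi>, \<eta>)\<in>R. (act g \<xi>, act g \<eta>) \<in> R) \<and>
     rays_converge bp emb R \<and>
     cones_converge bp emb R \<and>
     nonpinched_points bp emb R \<noteq> {} \<and>
     (\<forall>\<xi>\<in>nonpinched_points bp emb R. partition_closed_on R (\<Union>g\<in>\<Gamma>. act g ` (R `` {\<xi>})))"

text \<open>The class \<open>[f\<^sup>+]\<close> of a contracting isometry \<open>f\<close>: its positive orbit accumulates into a single
  class, which is therefore the saturation of the set of accumulation points.\<close>

definition attracting_class ::
  "'a::metric_space \<Rightarrow> ('a \<Rightarrow> 'b::metric_space) \<Rightarrow> ('b \<times> 'b) set \<Rightarrow> ('a \<Rightarrow> 'a) \<Rightarrow> 'b set" where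
  "attracting_class bp emb R f = R `` acc_points emb (\<lambda>n. (f [^]\<^bsub>isom_group\<^esub> n) bp)"

definition nonpinched_contracting ::
  "'a::metric_space \<Rightarrow> ('a \<Rightarrow> 'b::metric_space) \<Rightarrow> ('b \<times> 'b) set \<Rightarrow> ('a \<Rightarrow> 'a) \<Rightarrow> bool" where
  "nonpinched_contracting bp emb R f \<longleftrightarrow> contracting_isometry bp f \<and>
     attracting_class bp emb R f \<union> attracting_class bp emb R (inv\<^bsub>isom_group\<^esub> f)
       \<subseteq> nonpinched_points bp emb R"

definition elliptic_radical ::
  "'a::metric_space \<Rightarrow> ('a \<Rightarrow> 'b::metric_space) \<Rightarrow> (('a \<Rightarrow> 'a) \<Rightarrow> 'b \<Rightarrow> 'b) \<Rightarrow> ('b \<times> 'b) set \<Rightarrow>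
   ('a \<Rightarrow> 'a) set \<Rightarrow> ('a \<Rightarrow> 'a) set" where
  "elliptic_radical bp emb act R \<Gamma> = {g \<in> isometries. \<forall>\<xi>\<in>bdry emb.
     R `` {\<xi>} \<subseteq> R `` limit_set emb {h bp |h. h \<in> \<Gamma>} \<longrightarrow> act g ` (R `` {\<xi>}) = R `` {\<xi>}}"

section \<open>Busemann quasi-cocycles and quasi-conformal densities\<close>

definition busemann_cocycles ::
  "'a::metric_space \<Rightarrow> ('a \<Rightarrow> 'b::metric_space) \<Rightarrow> ('b \<times> 'b) set \<Rightarrow> 'b set \<Rightarrow>
   ('b \<Rightarrow> 'a \<Rightarrow> 'a \<Rightarrow> real) \<Rightarrow> real \<Rightarrow> bool" where
  "busemann_cocycles bp emb R Chor B \<epsilon> \<longleftrightarrow> Chor \<subseteq> nonpinched_points bp emb R \<and>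
     (\<forall>\<xi>\<in>Chor. \<forall>x y z. tends_to_class emb R z \<xi> \<longrightarrow>
        limsup (\<lambda>n. ereal \<bar>B \<xi> x y - (dist x (z n) - dist y (z n))\<bar>) \<le> ereal \<epsilon>)"

text \<open>Finite Borel measures on a compact metric space are Radon.  The Radon-Nikodym derivative
  \<open>d\<mu>\<^sub>x/d\<mu>\<^sub>y\<close> is \<open>RN_deriv (\<mu> y) (\<mu> x)\<close>, meaningful since \<open>\<mu>\<^sub>x\<close> is absolutely continuous with respect
  to \<open>\<mu>\<^sub>y\<close>.  As \<open>B\<^sub>\<xi>\<close> is only meaningful for \<open>\<xi> \<in> Chor\<close>, the density has to be carried by \<open>Chor\<close>.\<close>

definition qc_density ::
  "'a::metric_space \<Rightarrow> ('a \<Rightarrow> 'b::metric_space) \<Rightarrow> (('a \<Rightarrow> 'a) \<Rightarrow> 'b \<Rightarrow> 'b) \<Rightarrow> ('a \<Rightarrow> 'a) set \<Rightarrow>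
   'b set \<Rightarrow> ('b \<Rightarrow> 'a \<Rightarrow> 'a \<Rightarrow> real) \<Rightarrow> real \<Rightarrow> real \<Rightarrow> ('a \<Rightarrow> 'b measure) \<Rightarrow> bool" where
  "qc_density bp emb act H Chor B \<omega> L \<mu> \<longleftrightarrow>
     (\<forall>x. sets (\<mu> x) = sets borel \<and> finite_measure (\<mu> x)) \<and>
     measure (\<mu> bp) UNIV = 1 \<and>
     (\<forall>h\<in>H. \<forall>x.
        absolutely_continuous (\<mu> (h x)) (distr (\<mu> x) borel (act h)) \<and>
        (AE \<xi> in \<mu> (h x). RN_deriv (\<mu> (h x)) (distr (\<mu> x) borel (act h)) \<xi>
                             \<in> {ennreal (1 / L)..ennreal L})) \<and>
     (\<forall>x y.
        absolutely_continuous (\<mu> y) (\<mu> x) \<and>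
        (AE \<xi> in \<mu> y. \<xi> \<in> Chor \<and> RN_deriv (\<mu> y) (\<mu> x) \<xi>
                         \<in> {ennreal (1 / L * exp (- \<omega> * B \<xi> x y))..ennreal (L * exp (- \<omega> * B \<xi> x y))}))"

end

theory Submission
  imports Defs
begin

text \<open>Each element of \<open>P\<close> other than the identity has unbounded displacement on \<open>\<Gamma> o\<close>: otherwise
  assumption (B) would force it to fix every limit class.  On the complement of the shadow, the
  projection to a suitable contracting axis through \<open>y\<close> is close to \<open>y\<close>, and two contracting
  axes fellow-travel a common geodesic only if the displacement is bounded.  This yields an
  \<open>h \<in> H\<close>, moving \<open>y\<close> by a bounded amount, which maps the complement of the shadow into the
  shadow, so that by quasi-equivariance the shadow carries a definite part of the mass of \<open>\<mu>\<^sub>y\<close>.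
  Comparing \<open>\<mu>\<^sub>x\<close> with \<open>\<mu>\<^sub>y\<close> on the shadow by means of the Busemann cocycles gives both bounds.

  As \<open>P\<close> need not lie in \<open>\<Gamma>\<close>, an element of \<open>P\<close> outside \<open>E(\<Gamma>)\<close> may still fix an open set of
  limit classes, and no position on \<open>\<Gamma> o\<close> need be displaced a lot by all of \<open>P\<close>.  The discreteness of
  \<open>H\<close> excludes that the confining property only produces elements that fix too much.\<close>

section \<open>Isometries\<close>

text \<open>The difficulty is uniformity: for y = g o and every x, one bound on dist y (h y) and one
  radius must serve. The axis near y has to be chosen so that x and the base point o project close
  to its own base point, and o has to do the same on the corresponding axis at an auxiliary position
  g0 o. As \<Gamma> is not elementary, some h0 does not commensurate the powers of the contracting
  element, and this yields translates of the axis such that any given point projects far out on at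
  most one of them. Three conditions exclude at most three translates, so four suffice.

  To find h, let Q be a maximal subset of P - {id} that can be displaced arbitrarily far at a common
  position g0 o. Where Q is displaced far, the other elements displace by at most a fixed E. Far
  along the axis at g0 o more positions are tested than H has elements moving o by at most E. If
  none of them produced an element of Q, two would produce the same element of H, and a displacement
  exceeding E would equal one of at most E.\<close>

lemma isometriesD:
  assumes "g \<in> isometries"
  shows "dist (g x) (g y) = dist x y" "surj g" "inj g" "bij g"
    "g (inv_into UNIV g x) = x" "inv_into UNIV g (g x) = x"
proof -
  show d: "dist (g x) (g y) = dist x y" for x y
    using assms by (simp add: isometries_def)
  show s: "surj g" using assms by (simp add: isometries_def)
  show i: "inj g" by (rule injI) (metis d dist_eq_0_iff)
  show "bij g" using s i by (simp add: bij_def)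
  show "g (inv_into UNIV g x) = x" using s by (rule surj_f_inv_f)
  show "inv_into UNIV g (g x) = x" using i by simp
qed

lemma isometries_dist: "g \<in> isometries \<Longrightarrow> dist (g x) (g y) = dist x y"
  by (rule isometriesD)

lemma isometries_inv: "g \<in> isometries \<Longrightarrow> inv_into UNIV g \<in> isometries"
  unfolding isometries_def
  by (smt (verit) isometriesD(2,3) inj_imp_surj_inv isometries_def mem_Collect_eq surj_f_inv_f)

lemma isometries_dist_inv:
  "g \<in> isometries \<Longrightarrow> dist (inv_into UNIV g x) y = dist x (g y)"
  using isometries_dist[of g "inv_into UNIV g x" y] isometriesD(5)[of g x] by simp

lemma m_inv_isom_group:
  assumes "g \<in> isometries" shows "inv\<^bsub>isom_group\<^esub> g = inv_into UNIV g"
proof (rule group.inv_equality[OF group_isom_group])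
  show "inv_into UNIV g \<otimes>\<^bsub>isom_group\<^esub> g = \<one>\<^bsub>isom_group\<^esub>"
    using isometriesD(6)[OF assms] by (auto simp: isom_group_def fun_eq_iff)
qed (use assms isometries_inv in \<open>auto simp: isom_group_def\<close>)

lemma isom_subgroupD:
  assumes "subgroup G isom_group"
  shows "G \<subseteq> isometries" "id \<in> G" "g \<in> G \<Longrightarrow> h \<in> G \<Longrightarrow> g \<circ> h \<in> G"
    "g \<in> G \<Longrightarrow> inv_into UNIV g \<in> G"
proof -
  show sub: "G \<subseteq> isometries" using subgroup.subset[OF assms] by (simp add: isom_group_def)
  show "id \<in> G" using subgroup.one_closed[OF assms] by (simp add: isom_group_def)
  show "g \<in> G \<Longrightarrow> h \<in> G \<Longrightarrow> g \<circ> h \<in> G"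
    using subgroup.m_closed[OF assms] by (simp add: isom_group_def)
  show "g \<in> G \<Longrightarrow> inv_into UNIV g \<in> G"
    using subgroup.m_inv_closed[OF assms] sub by (metis m_inv_isom_group subsetD)
qed

section \<open>Geodesics\<close>

lemma geodesic_segment_param:
  assumes "geodesic_segment x y S"
  obtains \<gamma> where "\<gamma> 0 = x" "\<gamma> (dist x y) = y" "S = \<gamma> ` {0..dist x y}"
    "\<And>s t. s \<in> {0..dist x y} \<Longrightarrow> t \<in> {0..dist x y} \<Longrightarrow> dist (\<gamma> s) (\<gamma> t) = \<bar>s - t\<bar>"
  using assms unfolding geodesic_segment_def by blast

lemma geodesic_segment_dist:
  assumes "geodesic_segment x y S" "m \<in> S"
  shows "dist x m + dist m y = dist x y"
proof -
  obtain \<gamma> where \<gamma>: "\<gamma> 0 = x" "\<gamma> (dist x y) = y" "S = \<gamma> ` {0..dist x y}"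
    "\<And>s t. s \<in> {0..dist x y} \<Longrightarrow> t \<in> {0..dist x y} \<Longrightarrow> dist (\<gamma> s) (\<gamma> t) = \<bar>s - t\<bar>"
    using geodesic_segment_param[OF assms(1)] by blast
  obtain t where "t \<in> {0..dist x y}" "m = \<gamma> t" using assms(2) \<gamma>(3) by blast
  then show ?thesis using \<gamma>(4)[of 0 t] \<gamma>(4)[of t "dist x y"] \<gamma>(1,2) by auto
qed

lemma geodesic_segment_order:
  assumes "geodesic_segment x y S" "m \<in> S" "m' \<in> S"
  shows "dist m m' = \<bar>dist x m - dist x m'\<bar>"
proof -
  obtain \<gamma> where \<gamma>: "\<gamma> 0 = x" "\<gamma> (dist x y) = y" "S = \<gamma> ` {0..dist x y}"
    "\<And>s t. s \<in> {0..dist x y} \<Longrightarrow> t \<in> {0..dist x y} \<Longrightarrow> dist (\<gamma> s) (\<gamma> t) = \<bar>s - t\<bar>"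
    using geodesic_segment_param[OF assms(1)] by blast
  obtain s t where "s \<in> {0..dist x y}" "m = \<gamma> s" "t \<in> {0..dist x y}" "m' = \<gamma> t"
    using assms(2,3) \<gamma>(3) by blast
  then show ?thesis using \<gamma>(4)[of 0 t] \<gamma>(4)[of 0 s] \<gamma>(4)[of s t] \<gamma>(1,2) by auto
qed

lemma geodesic_segment_point:
  assumes "geodesic_segment x y S" "0 \<le> t" "t \<le> dist x y"
  obtains m where "m \<in> S" "dist x m = t" "dist m y = dist x y - t"
proof -
  obtain \<gamma> where \<gamma>: "\<gamma> 0 = x" "\<gamma> (dist x y) = y" "S = \<gamma> ` {0..dist x y}"
    "\<And>s t. s \<in> {0..dist x y} \<Longrightarrow> t \<in> {0..dist x y} \<Longrightarrow> dist (\<gamma> s) (\<gamma> t) = \<bar>s - t\<bar>"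
    using geodesic_segment_param[OF assms(1)] by blast
  have "dist x (\<gamma> t) = t" using \<gamma>(4)[of 0 t] \<gamma>(1) assms(2,3) by auto
  moreover have "dist (\<gamma> t) y = dist x y - t" using \<gamma>(4)[of t "dist x y"] \<gamma>(2) assms(2,3) by auto
  moreover have "\<gamma> t \<in> S" using \<gamma>(3) assms(2,3) by auto
  ultimately show ?thesis using that by blast
qed

lemma geodesic_segment_ends:
  assumes "geodesic_segment x y S" shows "x \<in> S" "y \<in> S"
proof -
  obtain \<gamma> where \<gamma>: "\<gamma> 0 = x" "\<gamma> (dist x y) = y" "S = \<gamma> ` {0..dist x y}"
    by (rule geodesic_segment_param[OF assms])
  have "\<gamma> 0 \<in> S" "\<gamma> (dist x y) \<in> S" unfolding \<gamma>(3) by (rule imageI, simp)+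
  then show "x \<in> S" "y \<in> S" by (simp_all only: \<gamma>(1,2))
qed

lemma geodesic_segment_sym:
  assumes "geodesic_segment x y S" shows "geodesic_segment y x S"
proof -
  obtain \<gamma> where \<gamma>: "\<gamma> 0 = x" "\<gamma> (dist x y) = y" "S = \<gamma> ` {0..dist x y}"
    "\<And>s t. s \<in> {0..dist x y} \<Longrightarrow> t \<in> {0..dist x y} \<Longrightarrow> dist (\<gamma> s) (\<gamma> t) = \<bar>s - t\<bar>"
    using geodesic_segment_param[OF assms(1)] by blast
  have "S = (\<lambda>t. \<gamma> (dist x y - t)) ` {0..dist x y}"
  proof -
    have "(\<lambda>t. dist x y - t) ` {0..dist x y} = {0..dist x y}"
      by (auto simp: image_iff intro!: bexI[of _ "dist x y - _"])
    then show ?thesis unfolding \<gamma>(3) by (metis image_image)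
  qed
  then show ?thesis
    unfolding geodesic_segment_def using \<gamma>
    by (intro exI[of _ "\<lambda>t. \<gamma> (dist x y - t)"]) (auto simp: dist_commute)
qed

lemma geodesic_segment_initial:
  assumes "geodesic_segment x y S" "m \<in> S"
  shows "geodesic_segment x m {u \<in> S. dist x u \<le> dist x m}"
proof -
  obtain \<gamma> where \<gamma>: "\<gamma> 0 = x" "\<gamma> (dist x y) = y" "S = \<gamma> ` {0..dist x y}"
    "\<And>s t. s \<in> {0..dist x y} \<Longrightarrow> t \<in> {0..dist x y} \<Longrightarrow> dist (\<gamma> s) (\<gamma> t) = \<bar>s - t\<bar>"
    using geodesic_segment_param[OF assms(1)] by blast
  obtain t where t: "t \<in> {0..dist x y}" "m = \<gamma> t" using assms(2) \<gamma>(3) by blast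
  have d: "dist x (\<gamma> s) = s" if "s \<in> {0..dist x y}" for s
    using \<gamma>(4)[of 0 s] \<gamma>(1) that by auto
  have "{u \<in> S. dist x u \<le> dist x m} = \<gamma> ` {0..dist x m}"
    unfolding \<gamma>(3) using d t by force
  then show ?thesis
    unfolding geodesic_segment_def using \<gamma> t d
    by (intro exI[of _ \<gamma>]) auto
qed

lemma geodesic_segment_split:
  assumes "geodesic_segment x y S" "m \<in> S"
  obtains S1 S2 where "geodesic_segment x m S1" "S1 \<subseteq> S" "geodesic_segment m y S2" "S2 \<subseteq> S"
proof -
  have "geodesic_segment m y {u \<in> S. dist y u \<le> dist y m}"
    using geodesic_segment_sym[OF geodesic_segment_initial[OF geodesic_segment_sym[OF assms(1)] assms(2)]] .
  then show ?thesis using that[OF geodesic_segment_initial[OF assms]] by blast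
qed

lemma geodesic_segment_between:
  assumes "geodesic_segment x y S" "m \<in> S"
    "geodesic_segment x m S1" "u \<in> S1" "geodesic_segment m y S2" "v \<in> S2"
  shows "dist u m + dist m v = dist u v"
  using geodesic_segment_dist[OF assms(1,2)] geodesic_segment_dist[OF assms(3,4)]
    geodesic_segment_dist[OF assms(5,6)] dist_triangle[of x y u] dist_triangle[of u y v]
    dist_triangle[of u v m] by linarith

lemma geodesic_segment_compact:
  assumes "geodesic_segment x y S" shows "compact S"
proof -
  obtain \<gamma> where \<gamma>: "\<gamma> 0 = x" "\<gamma> (dist x y) = y" "S = \<gamma> ` {0..dist x y}"
    "\<And>s t. s \<in> {0..dist x y} \<Longrightarrow> t \<in> {0..dist x y} \<Longrightarrow> dist (\<gamma> s) (\<gamma> t) = \<bar>s - t\<bar>"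
    using geodesic_segment_param[OF assms(1)] by blast
  have "continuous_on {0..dist x y} \<gamma>"
    unfolding continuous_on_iff using \<gamma>(4) by (auto simp: dist_real_def)
  then show ?thesis unfolding \<gamma>(3) by (rule compact_continuous_image) simp
qed

lemma geodesic_segment_image:
  assumes "geodesic_segment x y S" "g \<in> isometries"
  shows "geodesic_segment (g x) (g y) (g ` S)"
proof -
  obtain \<gamma> where \<gamma>: "\<gamma> 0 = x" "\<gamma> (dist x y) = y" "S = \<gamma> ` {0..dist x y}"
    "\<And>s t. s \<in> {0..dist x y} \<Longrightarrow> t \<in> {0..dist x y} \<Longrightarrow> dist (\<gamma> s) (\<gamma> t) = \<bar>s - t\<bar>"
    using geodesic_segment_param[OF assms(1)] by blast
  then show ?thesis unfolding geodesic_segment_def isometries_dist[OF assms(2)]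
    by (intro exI[of _ "g \<circ> \<gamma>"]) (auto simp: isometries_dist[OF assms(2)] image_comp)
qed

section \<open>Projections to contracting sets\<close>

lemma nearest_ptsD: "a \<in> nearest_pts Z x \<Longrightarrow> a \<in> Z" "a \<in> nearest_pts Z x \<Longrightarrow> dist x a = infdist x Z"
  by (auto simp: nearest_pts_def)

lemma nearest_pts_le: "a \<in> nearest_pts Z x \<Longrightarrow> b \<in> Z \<Longrightarrow> dist x a \<le> dist x b"
  by (auto simp: nearest_pts_def intro: infdist_le)

lemma nearest_pts_self: "a \<in> Z \<Longrightarrow> nearest_pts Z a = {a}"
  by (auto simp: nearest_pts_def)

lemma nearest_pts_nonempty:
  fixes Z :: "'a::heine_borel set"
  assumes "closed Z" "Z \<noteq> {}"
  obtains a where "a \<in> nearest_pts Z x"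
proof -
  obtain a where "a \<in> Z" "infdist x Z = dist x a" using infdist_attains_inf[OF assms, of x] .
  then show ?thesis using that[of a] by (simp add: nearest_pts_def)
qed

lemma infdist_isometry_image:
  assumes "g \<in> isometries" shows "infdist (g x) (g ` Z) = infdist x Z"
proof (cases "Z = {}")
  case False
  then show ?thesis
    by (simp add: infdist_def image_image isometries_dist[OF assms])
qed (simp add: infdist_def)

lemma nearest_pts_image:
  assumes "g \<in> isometries"
  shows "nearest_pts (g ` Z) (g x) = g ` nearest_pts Z x"
  unfolding nearest_pts_def infdist_isometry_image[OF assms]
  by (auto simp: isometries_dist[OF assms])

lemma nearest_pts_image_inv:
  assumes "g \<in> isometries"
  shows "nearest_pts (g ` Z) x = g ` nearest_pts Z (inv_into UNIV g x)"
  using nearest_pts_image[OF assms, of Z "inv_into UNIV g x"] by (simp add: isometriesD(5)[OF assms])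

lemma nearest_pts_between:
  assumes "b \<in> nearest_pts Z x" "dist x m + dist m b = dist x b"
  shows "b \<in> nearest_pts Z m"
proof -
  have b: "b \<in> Z" "dist x b = infdist x Z" using nearest_ptsD[OF assms(1)] by auto
  have "infdist m Z \<le> dist m b" using b(1) by (rule infdist_le)
  moreover have "infdist x Z \<le> infdist m Z + dist x m" by (rule infdist_triangle)
  ultimately show ?thesis using b assms(2) by (simp add: nearest_pts_def)
qed

lemma contracting_step:
  assumes "contracting C Z" "dist x y \<le> infdist x Z"
    "a \<in> nearest_pts Z x" "b \<in> nearest_pts Z y"
  shows "dist a b \<le> C"
proof -
  \<comment> \<open>\<open>diameter\<close> bounds distances only on bounded sets.\<close>
  have "bounded (nearest_pts Z z)" for z
    by (rule bounded_subset[OF bounded_cball[of z "infdist z Z"]]) (auto simp: nearest_pts_def)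
  then have "bounded (nearest_pts Z x \<union> nearest_pts Z y)" by simp
  then have "dist a b \<le> diameter (nearest_pts Z x \<union> nearest_pts Z y)"
    using assms(3,4) by (intro diameter_bounded_bound) auto
  also have "\<dots> \<le> C" using assms(1,2) by (simp add: contracting_def)
  finally show ?thesis .
qed

lemma contracting_mono: "contracting C Z \<Longrightarrow> C \<le> C' \<Longrightarrow> contracting C' Z"
  by (force simp: contracting_def)

lemma contracting_image:
  assumes "contracting C Z" "g \<in> isometries"
  shows "contracting C (g ` Z)"
proof -
  define g' where "g' = inv_into UNIV g"
  have g': "g' \<in> isometries" "\<And>x. g (g' x) = x" "\<And>x. g' (g x) = x"
    using isometries_inv[OF assms(2)] isometriesD[OF assms(2)] by (auto simp: g'_def)
  have "closed (g ` Z)"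
  proof -
    have "g ` Z = g' -` Z" using g'(2,3) by (auto intro: image_eqI[of _ g "g' _"])
    moreover have "continuous_on UNIV g'"
      unfolding continuous_on_iff using isometries_dist[OF g'(1)] by auto
    ultimately show ?thesis
      using assms(1) by (auto simp: contracting_def intro: closed_vimage)
  qed
  moreover have dia: "diameter (g ` T) = diameter T" for T
  proof -
    have "(\<lambda>(x, y). dist x y) ` (g ` T \<times> g ` T) = (\<lambda>(x, y). dist x y) ` (T \<times> T)" (is "?l = ?r")
    proof
      show "?l \<subseteq> ?r" using isometries_dist[OF assms(2)] by auto
      show "?r \<subseteq> ?l"
      proof
        fix d assume "d \<in> ?r"
        then obtain a b where "a \<in> T" "b \<in> T" "d = dist (g a) (g b)"
          using isometries_dist[OF assms(2)] by auto
        then show "d \<in> ?l" by (intro image_eqI[of _ _ "(g a, g b)"]) auto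
      qed
    qed
    then show ?thesis by (simp add: diameter_def)
  qed
  have "diameter (nearest_pts (g ` Z) x \<union> nearest_pts (g ` Z) y) \<le> C"
    if "dist x y \<le> infdist x (g ` Z)" for x y
  proof -
    have "dist (g' x) (g' y) \<le> infdist (g' x) Z"
      using that infdist_isometry_image[OF assms(2), of "g' x" Z] g' isometries_dist[OF g'(1)] by simp
    then have "diameter (nearest_pts Z (g' x) \<union> nearest_pts Z (g' y)) \<le> C"
      using assms(1) by (simp add: contracting_def)
    then show ?thesis
      unfolding nearest_pts_image_inv[OF assms(2)] g'_def[symmetric] image_Un[symmetric] dia .
  qed
  ultimately show ?thesis by (simp add: contracting_def)
qed

text \<open>Cut the geodesic into pieces of length 2C. Each piece starts at distance at least 2C
  from Z, so its projection moves by at most C: the projection travels at about half speed. The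
  endpoint \<open>v\<close> is exempt because no piece starts there.\<close>

lemma contracting_walk:
  fixes Z :: "'a::heine_borel set"
  assumes "C > 0" "contracting C Z" "Z \<noteq> {}"
  shows "geodesic_segment u v S \<Longrightarrow> (\<And>m. m \<in> S \<Longrightarrow> m \<noteq> v \<Longrightarrow> 2 * C \<le> infdist m Z) \<Longrightarrow>
    a \<in> nearest_pts Z u \<Longrightarrow> b \<in> nearest_pts Z v \<Longrightarrow> dist u v \<le> 2 * C * real (Suc n) \<Longrightarrow>
    dist a b \<le> C * real (Suc n)"
proof (induction n arbitrary: v S b)
  case 0
  show ?case
  proof (cases "u = v")
    case True
    then have "dist u v \<le> infdist u Z" by (simp add: infdist_nonneg)
    then show ?thesis using contracting_step[OF assms(2) _ 0(3,4)] by simp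
  next
    case False
    then have "dist u v \<le> infdist u Z"
      using 0(2)[of u] geodesic_segment_ends[OF 0(1)] 0(5) by simp
    then show ?thesis using contracting_step[OF assms(2) _ 0(3,4)] by simp
  qed
next
  case (Suc n)
  show ?case
  proof (cases "dist u v \<le> 2 * C * real (Suc n)")
    case True
    have "dist a b \<le> C * real (Suc n)" by (rule Suc.IH[OF Suc.prems(1-4) True])
    also have "\<dots> \<le> C * real (Suc (Suc n))" using assms(1) by simp
    finally show ?thesis .
  next
    case False
    obtain m where m: "m \<in> S" "dist u m = 2 * C * real (Suc n)"
      "dist m v = dist u v - 2 * C * real (Suc n)"
      using geodesic_segment_point[OF Suc.prems(1), of "2 * C * real (Suc n)"] False assms(1)
      by auto
    obtain c where c: "c \<in> nearest_pts Z m"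
      using nearest_pts_nonempty assms(2,3) by (metis contracting_def)
    have mv: "m \<noteq> v" using m False by auto
    have "dist a c \<le> C * real (Suc n)"
    proof (rule Suc.IH[OF geodesic_segment_initial[OF Suc.prems(1) m(1)] _ Suc.prems(3) c])
      fix w assume w: "w \<in> {x \<in> S. dist u x \<le> dist u m}" "w \<noteq> m"
      then have "w \<noteq> v" using m(2) False by auto
      then show "2 * C \<le> infdist w Z" using Suc.prems(2) w by auto
    qed (use m in simp)
    moreover have "dist c b \<le> C"
    proof (rule contracting_step[OF assms(2) _ c Suc.prems(4)])
      have "dist m v \<le> 2 * C" using m(3) Suc.prems(5) by (simp add: algebra_simps)
      also have "\<dots> \<le> infdist m Z" using Suc.prems(2) m mv by simp
      finally show "dist m v \<le> infdist m Z" .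
    qed
    moreover have "dist a b \<le> dist a c + dist c b" by (rule dist_triangle)
    ultimately show ?thesis by (simp add: algebra_simps)
  qed
qed

text \<open>The bound does not depend on the length. Cutting off pieces of lengths
  \<open>infdist x Z\<close> and \<open>infdist y Z\<close> at the ends costs C each, and by half
  speed the middle piece, of length l, contributes at most l / 2 + C. The triangle inequality
  through a and b gives l \<le> dist a b, so dist a b \<le> dist a b / 2 + 3C.\<close>

lemma contracting_far_geodesic:
  fixes Z :: "'a::heine_borel set"
  assumes C: "C > 0" "contracting C Z" and S: "geodesic_segment x y S"
    and far: "\<And>m. m \<in> S \<Longrightarrow> m \<noteq> y \<Longrightarrow> 2 * C \<le> infdist m Z"
    and a: "a \<in> nearest_pts Z x" and b: "b \<in> nearest_pts Z y"
  shows "dist a b \<le> 6 * C"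
proof (cases "dist x y \<le> infdist x Z")
  case True
  then show ?thesis using contracting_step[OF C(2) True a b] C(1) by simp
next
  case False
  have Z: "Z \<noteq> {}" using nearest_ptsD(1)[OF a] by auto
  obtain u where u: "u \<in> S" "dist x u = infdist x Z" "dist u y = dist x y - infdist x Z"
    using geodesic_segment_point[OF S infdist_nonneg[of x Z]] False by (metis linear)
  obtain au where au: "au \<in> nearest_pts Z u"
    using nearest_pts_nonempty C(2) Z by (metis contracting_def)
  have 1: "dist a au \<le> C" using contracting_step[OF C(2) _ a au] u(2) by simp
  show ?thesis
  proof (cases "dist u y \<le> infdist y Z")
    case True
    have "dist b au \<le> C" using contracting_step[OF C(2) _ b au] True by (simp add: dist_commute)
    then show ?thesis using 1 C(1) dist_triangle[of a b au] by (simp add: dist_commute)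
  next
    case False
    obtain S1 S2 where S2: "geodesic_segment u y S2" "S2 \<subseteq> S"
      using geodesic_segment_split[OF S u(1)] by metis
    obtain v where v: "v \<in> S2" "dist y v = infdist y Z" "dist v u = dist y u - infdist y Z"
      using geodesic_segment_point[OF geodesic_segment_sym[OF S2(1)] infdist_nonneg[of y Z]] False
      by (metis linear dist_commute)
    obtain av where av: "av \<in> nearest_pts Z v"
      using nearest_pts_nonempty C(2) Z by (metis contracting_def)
    have 2: "dist b av \<le> C" using contracting_step[OF C(2) _ b av] v(2) by simp
    define n where "n = nat \<lfloor>dist u v / (2 * C)\<rfloor>"
    have n: "real n \<le> dist u v / (2 * C)" "dist u v / (2 * C) \<le> real (Suc n)"
      unfolding n_def using C(1) by (auto simp: of_nat_nat) linarith
    have "dist au av \<le> C * real (Suc n)"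
    proof (rule contracting_walk[OF C Z geodesic_segment_initial[OF S2(1) v(1)] _ au av])
      fix m assume m: "m \<in> {w \<in> S2. dist u w \<le> dist u v}" "m \<noteq> v"
      show "2 * C \<le> infdist m Z"
      proof (cases "m = y")
        case True
        have "dist u v + dist v y = dist u y" using geodesic_segment_dist[OF S2(1) v(1)] .
        moreover have "dist u y \<le> dist u v" using m True by simp
        ultimately have "dist v y \<le> 0" by linarith
        then show ?thesis using m True by simp
      next
        case False
        then show ?thesis using far m S2(2) by auto
      qed
    next
      show "dist u v \<le> 2 * C * real (Suc n)" using n(2) C(1) by (simp add: field_simps)
    qed
    also have "\<dots> \<le> dist u v / 2 + C" using n(1) C(1) by (simp add: field_simps)
    finally have 3: "dist au av \<le> dist u v / 2 + C" .
    have "dist u v = dist x y - dist x a - dist y b"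
      using u(3) v(3) nearest_ptsD(2)[OF a] nearest_ptsD(2)[OF b] by (simp add: dist_commute)
    also have "\<dots> \<le> dist a b"
      using dist_triangle[of x y a] dist_triangle[of a y b] by (simp add: dist_commute)
    finally have 4: "dist u v \<le> dist a b" .
    have "dist a b \<le> dist a au + dist au av + dist av b"
      using dist_triangle[of a b au] dist_triangle[of au b av] by linarith
    then show ?thesis using 1 2 3 4 by (simp add: dist_commute)
  qed
qed

text \<open>A geodesic staying 2C away from Z would move the projection by at most 6C. Up to the
  first point within 2C of Z the projection is still within 6C of a, whence 8C = 6C + 2C.\<close>

lemma contracting_near:
  fixes Z :: "'a::heine_borel set"
  assumes C: "C > 0" "contracting C Z" and S: "geodesic_segment x y S"
    and a: "a \<in> nearest_pts Z x" and b: "b \<in> nearest_pts Z y" and ab: "dist a b > 6 * C"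
  obtains m where "m \<in> S" "dist m a \<le> 8 * C"
proof -
  define T where "T = S \<inter> {m. infdist m Z \<le> 2 * C}"
  have "compact T" unfolding T_def
    by (intro compact_Int_closed geodesic_segment_compact[OF S] closed_Collect_le continuous_intros)
  moreover have "T \<noteq> {}"
    using contracting_far_geodesic[OF C S _ a b] ab unfolding T_def by force
  ultimately obtain m where m: "m \<in> T" "\<And>m'. m' \<in> T \<Longrightarrow> dist x m \<le> dist x m'"
    using continuous_attains_inf[of T "dist x"]
      continuous_on_dist[OF continuous_on_const continuous_on_id, of T x] by blast
  have mS: "m \<in> S" using m(1) T_def by auto
  obtain c where c: "c \<in> nearest_pts Z m"
    using nearest_pts_nonempty C(2) nearest_ptsD(1)[OF a] by (metis contracting_def empty_iff)
  have "dist a c \<le> 6 * C"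
  proof (rule contracting_far_geodesic[OF C geodesic_segment_initial[OF S mS] _ a c])
    fix w assume w: "w \<in> {u \<in> S. dist x u \<le> dist x m}" "w \<noteq> m"
    then have "dist x w \<noteq> dist x m" using geodesic_segment_order[OF S, of w m] mS by auto
    then have "w \<notin> T" using m(2)[of w] w by auto
    then show "2 * C \<le> infdist w Z" using w T_def by auto
  qed
  moreover have "dist m c \<le> 2 * C" using nearest_ptsD(2)[OF c] m(1) T_def by auto
  ultimately have "dist m a \<le> 8 * C" using dist_triangle[of m a c] by (simp add: dist_commute)
  then show ?thesis using that mS by blast
qed

lemma contracting_near2:
  fixes Z :: "'a::heine_borel set"
  assumes C: "C > 0" "contracting C Z" and S: "geodesic_segment x y S"
    and a: "a \<in> nearest_pts Z x" and b: "b \<in> nearest_pts Z y" and ab: "dist a b > 6 * C"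
  obtains m where "m \<in> S" "dist m b \<le> 8 * C"
proof -
  have "dist b a > 6 * C" using ab by (simp add: dist_commute)
  then show ?thesis using contracting_near[OF C geodesic_segment_sym[OF S] b a] that by blast
qed

text \<open>Both halves of the geodesic come within 8C of c, so m lies between two points at
  distance at most 16C; this gives 16C + 8C.\<close>

lemma contracting_middle:
  fixes Z :: "'a::heine_borel set"
  assumes C: "C > 0" "contracting C Z" and S: "geodesic_segment x y S" "m \<in> S"
    and a: "a \<in> nearest_pts Z x" and b: "b \<in> nearest_pts Z y" and c: "c \<in> nearest_pts Z m"
    and far: "dist a c > 6 * C" "dist b c > 6 * C"
  shows "dist m c \<le> 24 * C"
proof -
  obtain S1 S2 where S12: "geodesic_segment x m S1" "geodesic_segment m y S2"
    using geodesic_segment_split[OF S] by metis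
  obtain u where u: "u \<in> S1" "dist u c \<le> 8 * C"
    using contracting_near2[OF C S12(1) a c far(1)] .
  obtain v where v: "v \<in> S2" "dist v c \<le> 8 * C"
    using contracting_near[OF C S12(2) c b far(2)[unfolded dist_commute[of b]]] .
  have "dist u m + dist m v = dist u v"
    using geodesic_segment_between[OF S S12(1) u(1) S12(2) v(1)] .
  then have "dist u m \<le> dist u v" using zero_le_dist[of m v] by linarith
  then have "dist u m \<le> 16 * C"
    using u(2) v(2) dist_triangle[of u v c] by (simp add: dist_commute)
  then show ?thesis using u(2) dist_triangle[of m c u] by (simp add: dist_commute)
qed

lemma contracting_quasiconvex:
  fixes Z :: "'a::heine_borel set"
  assumes C: "C > 0" "contracting C Z" and S: "geodesic_segment x y S" "m \<in> S"
    and xy: "x \<in> Z" "y \<in> Z"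
  obtains c where "c \<in> Z" "dist m c \<le> 24 * C"
proof -
  obtain c where c: "c \<in> nearest_pts Z m"
    using nearest_pts_nonempty C(2) xy by (metis contracting_def empty_iff)
  have x: "x \<in> nearest_pts Z x" and y: "y \<in> nearest_pts Z y" using xy nearest_pts_self by auto
  have mc: "dist m c \<le> dist m x" "dist m c \<le> dist m y" using nearest_pts_le[OF c] xy by auto
  have xmy: "dist x m + dist m y = dist x y" using geodesic_segment_dist[OF S] .
  obtain S1 S2 where S12: "geodesic_segment x m S1" "geodesic_segment m y S2"
    using geodesic_segment_split[OF S] by metis
  have "dist m c \<le> 24 * C"
  proof (cases "dist x c > 6 * C"; cases "dist y c > 6 * C")
    assume "dist x c > 6 * C" "dist y c > 6 * C"
    then show ?thesis using contracting_middle[OF C S x y c] by simp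
  next
    assume *: "dist x c > 6 * C" "\<not> dist y c > 6 * C"
    obtain u where u: "u \<in> S1" "dist u c \<le> 8 * C"
      using contracting_near2[OF C S12(1) x c *(1)] .
    have "dist u m + dist m y = dist u y"
      using geodesic_segment_between[OF S S12(1) u(1) S12(2) geodesic_segment_ends(2)[OF S12(2)]] .
    then have "dist m y \<le> dist u y" using zero_le_dist[of u m] by linarith
    then show ?thesis
      using * u mc(2) C(1) dist_triangle[of u y c] by (simp add: dist_commute)
  next
    assume *: "\<not> dist x c > 6 * C" "dist y c > 6 * C"
    obtain v where v: "v \<in> S2" "dist v c \<le> 8 * C"
      using contracting_near[OF C S12(2) c y *(2)[unfolded dist_commute[of y]]] .
    have "dist x m + dist m v = dist x v"
      using geodesic_segment_between[OF S S12(1) geodesic_segment_ends(1)[OF S12(1)] S12(2) v(1)] .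
    then have "dist x m \<le> dist x v" using zero_le_dist[of m v] by linarith
    then show ?thesis
      using * v mc(1) C(1) dist_triangle[of x v c] by (simp add: dist_commute)
  next
    assume "\<not> dist x c > 6 * C" "\<not> dist y c > 6 * C"
    then show ?thesis using xmy mc C(1) dist_triangle[of x y c] by (simp add: dist_commute)
  qed
  then show ?thesis using that nearest_ptsD(1)[OF c] by blast
qed

text \<open>When the projections are more than 6C apart, the geodesic passes within 8C of each of
  them.\<close>

lemma contracting_proj_lipschitz:
  fixes Z :: "'a::heine_borel set"
  assumes geo: "\<And>x y :: 'a. \<exists>S. geodesic_segment x y S" and C: "C > 0" "contracting C Z"
    and a: "a \<in> nearest_pts Z x" and b: "b \<in> nearest_pts Z y"
  shows "dist a b \<le> dist x y + 16 * C"
proof (cases "dist a b > 6 * C")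
  case True
  obtain S where S: "geodesic_segment x y S" using geo by blast
  obtain m where m: "m \<in> S" "dist m a \<le> 8 * C" using contracting_near[OF C S a b True] .
  obtain m' where m': "m' \<in> S" "dist m' b \<le> 8 * C" using contracting_near2[OF C S a b True] .
  have "dist m m' \<le> dist x y"
    using geodesic_segment_order[OF S m(1) m'(1)] geodesic_segment_dist[OF S m(1)]
      geodesic_segment_dist[OF S m'(1)] zero_le_dist[of x m] zero_le_dist[of x m']
      zero_le_dist[of m y] zero_le_dist[of m' y] by linarith
  then show ?thesis
    using m m' dist_triangle[of a b m] dist_triangle[of m b m'] by (simp add: dist_commute)
next
  case False
  have "dist a b \<le> 6 * C" using False by simp
  also have "\<dots> \<le> dist x y + 16 * C" using C(1) zero_le_dist[of x y] by linarith
  finally show ?thesis .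
qed

text \<open>The geodesic from \<open>z\<close> to \<open>v\<close> passes close both to \<open>\<alpha>\<close> and to the projection of \<open>z\<close> to \<open>q Y\<close>,
  which is close to \<open>q \<alpha>\<close>; the two points have almost the same distance from \<open>z\<close>.\<close>

lemma contracting_small_displacement:
  fixes Y :: "'a::heine_borel set"
  assumes geo: "\<And>x y :: 'a. \<exists>S. geodesic_segment x y S" and C: "C > 0" "contracting C Y"
    and q: "q \<in> isometries"
    and \<alpha>: "\<alpha> \<in> nearest_pts Y z" and \<beta>: "\<beta> \<in> nearest_pts Y (q v)" and \<beta>': "\<beta>' \<in> nearest_pts Y v"
    and far: "dist \<alpha> \<beta> > 22 * C + dist z (q z)" "dist \<alpha> \<beta>' > 22 * C + dist z (q z)"
  shows "dist \<alpha> (q \<alpha>) \<le> 48 * C + 2 * dist z (q z)"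
proof -
  have C': "contracting C (q ` Y)" using contracting_image[OF C(2) q] .
  obtain \<alpha>q where \<alpha>q: "\<alpha>q \<in> nearest_pts (q ` Y) z"
    using nearest_pts_nonempty C' nearest_ptsD(1)[OF \<alpha>] by (metis contracting_def empty_iff imageI)
  have q\<alpha>: "q \<alpha> \<in> nearest_pts (q ` Y) (q z)" and q\<beta>: "q \<beta>' \<in> nearest_pts (q ` Y) (q v)"
    using \<alpha> \<beta>' nearest_pts_image[OF q] by auto
  have 1: "dist \<alpha>q (q \<alpha>) \<le> dist z (q z) + 16 * C"
    by (rule contracting_proj_lipschitz[OF geo C(1) C' \<alpha>q q\<alpha>])
  obtain S where S: "geodesic_segment z (q v) S" using geo by blast
  have "dist \<alpha> \<beta> > 6 * C" using far(1) C(1) zero_le_dist[of z "q z"] by linarith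
  then obtain m where m: "m \<in> S" "dist m \<alpha> \<le> 8 * C" using contracting_near[OF C S \<alpha> \<beta>] by blast
  have "dist \<alpha>q (q \<beta>') > 6 * C"
    using 1 far(2) dist_triangle[of "q \<alpha>" "q \<beta>'" \<alpha>q] isometries_dist[OF q, of \<alpha> \<beta>']
    by (simp add: dist_commute)
  then obtain m' where m': "m' \<in> S" "dist m' \<alpha>q \<le> 8 * C"
    using contracting_near[OF C(1) C' S \<alpha>q q\<beta>] by blast
  have mm: "dist m m' = \<bar>dist z m - dist z m'\<bar>" by (rule geodesic_segment_order[OF S m(1) m'(1)])
  have "infdist (q z) (q ` Y) = infdist z Y" by (rule infdist_isometry_image[OF q])
  then have "\<bar>dist z \<alpha>q - dist z \<alpha>\<bar> \<le> dist z (q z)"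
    using infdist_triangle[of z "q ` Y" "q z"] infdist_triangle[of "q z" "q ` Y" z]
      nearest_ptsD(2)[OF \<alpha>] nearest_ptsD(2)[OF \<alpha>q] by (auto simp: dist_commute)
  then have "dist m m' \<le> dist z (q z) + 16 * C"
    using mm m(2) m'(2) dist_triangle[of z m \<alpha>] dist_triangle[of z \<alpha> m]
      dist_triangle[of z m' \<alpha>q] dist_triangle[of z \<alpha>q m'] by (simp add: dist_commute)
  \<comment> \<open>With d = dist z (q z), the path from \<alpha> to q \<alpha> through m, m' and
    \<alpha>q contributes 8C, d + 16C, 8C and d + 16C.\<close>
  then show ?thesis
    using 1 m(2) m'(2) dist_triangle[of \<alpha> "q \<alpha>" m] dist_triangle[of m "q \<alpha>" m']
      dist_triangle[of m' "q \<alpha>" \<alpha>q] by (simp add: dist_commute)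
qed

section \<open>Discrete groups of isometries\<close>

text \<open>Discreteness refers to pointwise convergence, where a neighbourhood of \<open>id\<close>
  restricts only finitely many coordinates \<open>I\<close>. Isometries of bounded displacement have
  their values at each i in one compact ball, so among infinitely many of them two are so close on
  \<open>I\<close> that the inverse of one composed with the other lies in the
  neighbourhood.\<close>

lemma finite_discrete_isometries:
  fixes bp :: "'a::heine_borel"
  assumes G: "subgroup G isom_group" and "discrete G"
  shows "finite {g \<in> G. dist bp (g bp) \<le> R}"
proof (rule ccontr)
  define S where "S = {g \<in> G. dist bp (g bp) \<le> R}"
  assume "infinite {g \<in> G. dist bp (g bp) \<le> R}"
  then have inf: "infinite S" by (simp add: S_def)
  note GD = isom_subgroupD[OF G]
  have "id isolated_in G" using assms(2) GD(2) by (simp add: discrete_def)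
  then obtain T where T: "open T" "T \<inter> G = {id}" by (auto simp: isolated_in_def)
  then have "openin (product_topology (\<lambda>i. euclidean) UNIV) T" "id \<in> T"
    by (auto simp: open_fun_def)
  then obtain X where X: "id \<in> (\<Pi>\<^sub>E i\<in>UNIV. X i)" "\<And>i. openin euclidean (X i)"
    "finite {i. X i \<noteq> topspace euclidean}" "(\<Pi>\<^sub>E i\<in>UNIV. X i) \<subseteq> T"
    using product_topology_open_contains_basis[of "\<lambda>i. euclidean" UNIV T id] by blast
  define I where "I = {i. X i \<noteq> UNIV}"
  have I: "finite I" using X(3) by (simp add: I_def)
  have "\<exists>e>0. ball i e \<subseteq> X i" for i
    using X(1,2) open_contains_ball[of "X i"] by (auto simp: PiE_iff)
  then obtain e where e: "\<And>i. e i > 0" "\<And>i. ball i (e i) \<subseteq> X i" by metis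
  have "\<exists>k. finite k \<and> cball bp (R + dist bp i) \<subseteq> (\<Union>x\<in>k. ball x (e i / 2))" for i
    using compact_cball[of bp "R + dist bp i"] e(1)[of i] unfolding compact_eq_totally_bounded
    by (meson half_gt_zero)
  then obtain k where k: "\<And>i. finite (k i)"
    "\<And>i. cball bp (R + dist bp i) \<subseteq> (\<Union>x\<in>k i. ball x (e i / 2))" by metis
  have "\<exists>x\<in>k i. dist x (g i) < e i / 2" if "g \<in> S" for g i
  proof -
    have "dist bp (g i) \<le> dist bp (g bp) + dist (g bp) (g i)" by (rule dist_triangle)
    also have "dist (g bp) (g i) = dist bp i" using that GD(1) isometries_dist by (auto simp: S_def)
    finally have "g i \<in> cball bp (R + dist bp i)" using that by (simp add: S_def)
    then obtain x where "x \<in> k i" "g i \<in> ball x (e i / 2)" using k(2)[of i] by blast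
    then show ?thesis by auto
  qed
  then obtain q where q: "\<And>g i. g \<in> S \<Longrightarrow> q g i \<in> k i" "\<And>g i. g \<in> S \<Longrightarrow> dist (q g i) (g i) < e i / 2"
    by metis
  have "(\<lambda>g. restrict (q g) I) ` S \<subseteq> (\<Pi>\<^sub>E i\<in>I. k i)" using q(1) by auto
  then have "finite ((\<lambda>g. restrict (q g) I) ` S)"
    using finite_PiE[OF I, of k] k(1) finite_subset by blast
  then have "\<not> inj_on (\<lambda>g. restrict (q g) I) S" using inf finite_imageD by blast
  then obtain g h where gh: "g \<in> S" "h \<in> S" "g \<noteq> h" "restrict (q g) I = restrict (q h) I"
    unfolding inj_on_def by blast
  have isg: "g \<in> isometries" using gh(1) GD(1) by (auto simp: S_def)
  have mem: "inv_into UNIV g \<circ> h \<in> G" using gh GD(3,4) by (simp add: S_def)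
  have "(inv_into UNIV g \<circ> h) i \<in> X i" for i
  proof (cases "i \<in> I")
    case True
    then have "q g i = q h i" using gh(4) by (metis restrict_apply')
    then have "dist (g i) (h i) < e i"
      using q(2)[OF gh(1), of i] q(2)[OF gh(2), of i] dist_triangle_half_r[of "q g i"] by metis
    then have "dist i (inv_into UNIV g (h i)) < e i"
      using isometries_dist_inv[OF isg, of "h i" i] by (simp add: dist_commute)
    then show ?thesis using e(2)[of i] by auto
  qed (simp add: I_def)
  then have "inv_into UNIV g \<circ> h \<in> (\<Pi>\<^sub>E i\<in>UNIV. X i)" by (simp add: PiE_iff)
  then have "inv_into UNIV g \<circ> h = id" using X(4) T(2) mem by blast
  then have "h x = g x" for x using isometriesD(5)[OF isg, of "h x"] by (metis comp_apply id_apply)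
  then show False using gh(3) by auto
qed

section \<open>Contracting axes\<close>

text \<open>\<open>F n\<close> stands for the n-th power of a contracting element of \<Gamma>, and
  the orbit of \<open>bp\<close> under these powers serves as its axis. Discreteness of \<Gamma>
  enters in the form \<open>proper\<close>.\<close>

locale axis =
  fixes bp :: "'a::heine_borel" and \<Gamma> :: "('a \<Rightarrow> 'a) set" and F :: "int \<Rightarrow> 'a \<Rightarrow> 'a" and C c :: real
  assumes geo: "\<exists>S. geodesic_segment (x::'a) y S"
    and isom: "g \<in> \<Gamma> \<Longrightarrow> g \<in> isometries"
    and comp: "g \<in> \<Gamma> \<Longrightarrow> h \<in> \<Gamma> \<Longrightarrow> g \<circ> h \<in> \<Gamma>"
    and inv: "g \<in> \<Gamma> \<Longrightarrow> inv_into UNIV g \<in> \<Gamma>"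
    and proper: "finite {g \<in> \<Gamma>. dist bp (g bp) \<le> R}"
    and F_mem: "F n \<in> \<Gamma>" and F_add: "F (m + n) = F m \<circ> F n"
    and C: "C > 0" and contr: "contracting C (range (\<lambda>n. F n bp))" and c: "c \<ge> 1"
    and qi_lower: "real_of_int \<bar>m - n\<bar> / c - c \<le> dist (F m bp) (F n bp)"
    and qi_upper: "dist (F m bp) (F n bp) \<le> c * real_of_int \<bar>m - n\<bar> + c"
begin

definition A where "A = range (\<lambda>n. F n bp)"

lemma A_contr: "contracting C A"
  using contr by (simp add: A_def)

lemma A_mem: "F n bp \<in> A"
  by (simp add: A_def)

lemma F_isom: "F n \<in> isometries"
  using isom F_mem by blast

lemma F_zero: "F 0 = id"
proof
  fix x
  have "F 0 (F 0 x) = F 0 x" using F_add[of 0 0] by (metis add_0 comp_apply)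
  then show "F 0 x = id x" using isometriesD(3)[OF F_isom, of 0] by (simp add: inj_eq)
qed

lemma bp_A: "bp \<in> A"
  using A_mem[of 0] by (simp add: F_zero)

lemma F_comp: "F m (F n x) = F (m + n) x"
  by (simp add: F_add)

lemma F_neg: "F n (F (- n) x) = x" "F (- n) (F n x) = x"
  by (simp_all add: F_comp F_zero)

lemma F_dist: "dist (F n x) (F n y) = dist x y"
  by (rule isometries_dist[OF F_isom])

lemma F_dist_neg: "dist (F n x) y = dist x (F (- n) y)"
  using F_dist[of n x "F (- n) y"] by (simp add: F_neg)

lemma F_A: "F n ` A = A"
proof -
  have "x \<in> F n ` A" if "x \<in> A" for x
  proof -
    obtain k where "x = F k bp" using \<open>x \<in> A\<close> by (auto simp: A_def)
    then have "x = F n (F (k - n) bp)" by (simp add: F_comp)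
    then show ?thesis using A_mem by blast
  qed
  moreover have "F n x \<in> A" if "x \<in> A" for x
    using that by (auto simp: A_def F_comp)
  ultimately show ?thesis by blast
qed

lemma proj_ex: obtains a where "a \<in> nearest_pts A x"
  using nearest_pts_nonempty[of A x] A_contr bp_A by (auto simp: contracting_def)

lemma proj_index: obtains n where "F n bp \<in> nearest_pts A x"
proof -
  obtain a where a: "a \<in> nearest_pts A x" by (rule proj_ex)
  then obtain n where "a = F n bp" using nearest_ptsD(1)[OF a] by (auto simp: A_def)
  then show ?thesis using that a by blast
qed

lemma proj_F: "a \<in> nearest_pts A x \<Longrightarrow> F n a \<in> nearest_pts A (F n x)"
  using nearest_pts_image[OF F_isom, of n A x] by (simp add: F_A)

lemma proj_lipschitz: "a \<in> nearest_pts A x \<Longrightarrow> b \<in> nearest_pts A y \<Longrightarrow> dist a b \<le> dist x y + 16 * C"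
  by (rule contracting_proj_lipschitz[OF geo C A_contr])

lemma F_escapes: obtains N where "N > 0" "\<And>n. \<bar>n\<bar> \<ge> N \<Longrightarrow> dist bp (F n bp) > D"
proof -
  define N where "N = \<lceil>c * (\<bar>D\<bar> + c)\<rceil> + 1"
  have "c * (\<bar>D\<bar> + c) \<ge> 0" using c by simp
  then have "N > 0" unfolding N_def by linarith
  moreover have "dist bp (F n bp) > D" if "\<bar>n\<bar> \<ge> N" for n
  proof -
    have "c * (\<bar>D\<bar> + c) < real_of_int N" unfolding N_def by linarith
    also have "\<dots> \<le> real_of_int \<bar>n\<bar>" using that by linarith
    finally have "\<bar>D\<bar> + c < real_of_int \<bar>n\<bar> / c" using c by (simp add: field_simps)
    then show ?thesis using qi_lower[of 0 n] by (simp add: F_zero)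
  qed
  ultimately show ?thesis using that by blast
qed

lemma F_pow:
  assumes "h \<circ> F n = F m \<circ> h"
  shows "h \<circ> F (n * k) = F (m * k) \<circ> h"
proof -
  have nat: "h (F (n * int j) x) = F (m * int j) (h x)" for j x
  proof (induction j arbitrary: x)
    case (Suc j)
    have "h (F (n * int (Suc j)) x) = h (F n (F (n * int j) x))"
      by (simp add: F_comp algebra_simps)
    also have "\<dots> = F m (h (F (n * int j) x))" using assms by (metis comp_apply)
    also have "\<dots> = F (m * int (Suc j)) (h x)" by (simp add: Suc.IH F_comp algebra_simps)
    finally show ?case .
  qed (simp add: F_zero)
  have "h (F (n * k) x) = F (m * k) (h x)" for x
  proof (cases "k \<ge> 0")
    case True
    then show ?thesis using nat[of "nat k"] by simp
  next
    case False
    then have k: "int (nat (- k)) = - k" by simp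
    have "F (m * k) (h x) = F (m * k) (h (F (n * int (nat (- k))) (F (n * k) x)))"
      unfolding k by (simp add: F_comp F_zero)
    also have "\<dots> = h (F (n * k) x)" unfolding nat unfolding k by (simp add: F_comp F_zero)
    finally show ?thesis by simp
  qed
  then show ?thesis by auto
qed

lemma F_inj: "F n = id \<longleftrightarrow> n = 0"
proof
  assume n: "F n = id"
  obtain N where N: "N > 0" "\<And>n. \<bar>n\<bar> \<ge> N \<Longrightarrow> dist bp (F n bp) > 0" using F_escapes[of 0] by blast
  \<comment> \<open>F n = F 0 is read as an intertwining relation by \<open>id\<close>, which then
    passes to multiples.\<close>
  have "id \<circ> F (n * N) = F (0 * N) \<circ> id" by (rule F_pow) (simp add: n F_zero)
  then have "dist bp (F (n * N) bp) = 0" by (simp add: F_zero)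
  then have "\<not> \<bar>n * N\<bar> \<ge> N" using N(2) by force
  then have "\<bar>n\<bar> * N < 1 * N" using N(1) by (simp add: abs_mult)
  then show "n = 0" using N(1) by (simp only: mult_less_cancel_right) linarith
qed (simp add: F_zero)

lemma sign_change:
  fixes I :: "nat \<Rightarrow> int"
  shows "I 0 < 0 \<Longrightarrow> I n \<ge> 0 \<Longrightarrow> \<exists>q<n. I q < 0 \<and> I (Suc q) \<ge> 0"
  by (induction n) (auto simp: less_Suc_eq not_less intro: leI)

text \<open>Along the geodesic the projection moves in steps of bounded length, so it has to pass close
  to the base point.\<close>

lemma geodesic_passes_bp:
  obtains K where "\<And>x y S i j. geodesic_segment x y S \<Longrightarrow> F i bp \<in> nearest_pts A x \<Longrightarrow>
    F j bp \<in> nearest_pts A y \<Longrightarrow> i < 0 \<Longrightarrow> j > 0 \<Longrightarrow> dist bp (F i bp) > K \<Longrightarrow>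
    dist bp (F j bp) > K \<Longrightarrow> \<exists>m\<in>S. dist m bp \<le> K"
proof -
  \<comment> \<open>Consecutive sample points are at most 1 apart, so the projection moves by at
    most 1 + 16C and its index by at most c * (1 + 16C + c). The index just after a sign change is
    no larger than this step, and \<open>K1\<close> bounds the distance of its point from
    \<open>bp\<close>.\<close>
  define K1 where "K1 = c * (c * (1 + 16 * C + c)) + c"
  have "\<exists>m\<in>S. dist m bp \<le> K1 + 24 * C"
    if S: "geodesic_segment x y S" and x: "F i bp \<in> nearest_pts A x"
      and y: "F j bp \<in> nearest_pts A y" and ij: "i < 0" "j > 0"
      and far: "dist bp (F i bp) > K1 + 24 * C" "dist bp (F j bp) > K1 + 24 * C" for x y S i j
  proof -
    obtain \<gamma> where \<gamma>: "\<gamma> 0 = x" "\<gamma> (dist x y) = y" "S = \<gamma> ` {0..dist x y}"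
      "\<And>s t. s \<in> {0..dist x y} \<Longrightarrow> t \<in> {0..dist x y} \<Longrightarrow> dist (\<gamma> s) (\<gamma> t) = \<bar>s - t\<bar>"
      using geodesic_segment_param[OF S] by blast
    define N where "N = Suc (nat \<lceil>dist x y\<rceil>)"
    have N: "dist x y \<le> real N" "N > 0" unfolding N_def by linarith+
    define t where "t q = real q * (dist x y / real N)" for q
    have t_step: "\<bar>t q - t (Suc q)\<bar> \<le> 1" for q
    proof -
      have "t (Suc q) = t q + dist x y / real N" by (simp add: t_def algebra_simps add_divide_distrib)
      moreover have "dist x y / real N \<le> 1" "0 \<le> dist x y / real N" using N by auto
      ultimately show ?thesis by simp
    qed
    have t_mem: "t q \<in> {0..dist x y}" if "q \<le> N" for q
      using that N by (auto simp: t_def field_simps intro: mult_right_mono)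
    have "\<exists>I. F I bp \<in> nearest_pts A (\<gamma> (t q))" for q
      by (rule proj_index[of "\<gamma> (t q)"]) blast
    then obtain J where J: "\<And>q. F (J q) bp \<in> nearest_pts A (\<gamma> (t q))" by metis
    \<comment> \<open>Projections need not be unique, so the given indices i and j are imposed at
      the two ends.\<close>
    define I where "I q = (if q = 0 then i else if q = N then j else J q)" for q
    have I: "F (I q) bp \<in> nearest_pts A (\<gamma> (t q))" for q
      using J x y \<gamma>(1,2) N by (auto simp: I_def t_def)
    obtain q where q: "q < N" "I q < 0" "I (Suc q) \<ge> 0"
      using sign_change[of I N] ij N by (auto simp: I_def)
    define a b m where "a = I q" and "b = I (Suc q)" and "m = \<gamma> (t (Suc q))"
    have m: "m \<in> S" "F b bp \<in> nearest_pts A m"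
      using \<gamma>(3) t_mem q(1) I by (auto simp: m_def b_def)
    have "dist (F a bp) (F b bp) \<le> dist (\<gamma> (t q)) m + 16 * C"
      using proj_lipschitz[OF I m(2)] by (simp add: a_def)
    also have "dist (\<gamma> (t q)) m \<le> 1" using \<gamma>(4)[of "t q" "t (Suc q)"] t_mem q(1) t_step by (simp add: m_def)
    finally have "real_of_int \<bar>a - b\<bar> / c \<le> 1 + 16 * C + c" using qi_lower[of a b] by linarith
    then have "real_of_int \<bar>a - b\<bar> \<le> c * (1 + 16 * C + c)" using c by (simp add: field_simps)
    moreover have "real_of_int \<bar>0 - b\<bar> \<le> real_of_int \<bar>a - b\<bar>" using q by (simp add: a_def b_def)
    ultimately have "c * real_of_int \<bar>0 - b\<bar> \<le> c * (c * (1 + 16 * C + c))"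
      using c by (intro mult_left_mono) linarith+
    then have b: "dist bp (F b bp) \<le> K1" using qi_upper[of 0 b] by (simp add: F_zero K1_def)
    have "dist m (F b bp) \<le> 24 * C"
    proof (rule contracting_middle[OF C A_contr S m(1) x y m(2)])
      show "dist (F i bp) (F b bp) > 6 * C" "dist (F j bp) (F b bp) > 6 * C"
        using far b C dist_triangle[of bp "F i bp" "F b bp"] dist_triangle[of bp "F j bp" "F b bp"]
        by (simp_all add: dist_commute)
    qed
    then have "dist m bp \<le> K1 + 24 * C"
      using b dist_triangle[of m bp "F b bp"] by (simp add: dist_commute)
    then show ?thesis using m(1) by blast
  qed
  then show ?thesis using that by blast
qed

text \<open>For large k the inverse g of h carries the points of A with indices - m * k and m * k to
  points that project far out on opposite sides of \<open>bp\<close>. The geodesic between the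
  images passes within K of \<open>bp\<close>, and h maps it to a geodesic with ends in A, which
  stays 24C-close to A. The choice of k depends on h, but the bound K + 24C does not.\<close>

lemma commensurating_near:
  obtains D where "\<And>h n m. h \<in> \<Gamma> \<Longrightarrow> n \<noteq> 0 \<Longrightarrow> h \<circ> F n = F m \<circ> h \<Longrightarrow> \<exists>a\<in>A. dist (h bp) a \<le> D"
proof -
  obtain K where K: "\<And>x y S i j. geodesic_segment x y S \<Longrightarrow> F i bp \<in> nearest_pts A x \<Longrightarrow>
    F j bp \<in> nearest_pts A y \<Longrightarrow> i < 0 \<Longrightarrow> j > 0 \<Longrightarrow> dist bp (F i bp) > K \<Longrightarrow>
    dist bp (F j bp) > K \<Longrightarrow> \<exists>m\<in>S. dist m bp \<le> K"
    using geodesic_passes_bp by blast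
  have "\<exists>a\<in>A. dist (h bp) a \<le> K + 24 * C"
    if h: "h \<in> \<Gamma>" and n: "n \<noteq> 0" and hF: "h \<circ> F n = F m \<circ> h" for h n m
  proof -
    note hi = isom[OF h]
    define g where "g = inv_into UNIV h"
    have gi: "g \<in> isometries" and gh: "g (h x) = x" "h (g x) = x" for x
      using isometries_inv[OF hi] isometriesD[OF hi] by (auto simp: g_def)
    have gF: "g (F (m * k) x) = F (n * k) (g x)" for k x
      using fun_cong[OF F_pow[OF hF, of k], of "g x"] gh by (metis comp_apply)
    obtain N where N: "N > 0" "\<And>k. \<bar>k\<bar> \<ge> N \<Longrightarrow> dist bp (F k bp) > \<bar>K\<bar>" using F_escapes[of "\<bar>K\<bar>"] by blast
    define B where "B = c * (dist (g bp) bp + 16 * C + c)"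
    \<comment> \<open>The sign makes n * k positive; \<open>B\<close> is the error in the index of
      the projection.\<close>
    define k where "k = sgn n * (\<lceil>B\<rceil> + N)"
    have B0: "B \<ge> 0" using c C by (simp add: B_def)
    have nk: "n * k \<ge> \<lceil>B\<rceil> + N"
    proof -
      have "n * k = \<bar>n\<bar> * (\<lceil>B\<rceil> + N)" by (simp add: k_def abs_sgn algebra_simps)
      moreover have "1 * (\<lceil>B\<rceil> + N) \<le> \<bar>n\<bar> * (\<lceil>B\<rceil> + N)"
        using n N(1) B0 by (intro mult_right_mono) (auto simp: add_nonneg_nonneg)
      ultimately show ?thesis by simp
    qed
    have close: "\<bar>i - n * l\<bar> \<le> \<lceil>B\<rceil>" if i: "F i bp \<in> nearest_pts A (g (F (m * l) bp))" for i l
    proof -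
      have "F (n * l) bp \<in> nearest_pts A (F (n * l) bp)" using nearest_pts_self[OF A_mem] by simp
      from proj_lipschitz[OF i this] have "dist (F i bp) (F (n * l) bp) \<le> dist (g bp) bp + 16 * C"
        unfolding gF by (simp add: F_dist)
      then have "real_of_int \<bar>i - n * l\<bar> / c \<le> dist (g bp) bp + 16 * C + c"
        using qi_lower[of i "n * l"] by linarith
      then have "real_of_int \<bar>i - n * l\<bar> \<le> B" using c by (simp add: B_def field_simps)
      then show ?thesis by (meson le_of_int_ceiling of_int_le_iff order_trans)
    qed
    obtain i where i: "F i bp \<in> nearest_pts A (g (F (m * (- k)) bp))"
      by (rule proj_index)
    obtain j where j: "F j bp \<in> nearest_pts A (g (F (m * k) bp))"
      by (rule proj_index)
    have ij: "i \<le> - N" "j \<ge> N"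
      using close[OF i] close[OF j] nk unfolding mult_minus_right by linarith+
    obtain S where S: "geodesic_segment (g (F (m * (- k)) bp)) (g (F (m * k) bp)) S" using geo by blast
    obtain u where u: "u \<in> S" "dist u bp \<le> K"
      using K[OF S i j] ij N(1) N(2)[of i] N(2)[of j] by force
    have "geodesic_segment (F (m * (- k)) bp) (F (m * k) bp) (h ` S)"
      using geodesic_segment_image[OF S hi] by (simp add: gh)
    then obtain a where a: "a \<in> A" "dist (h u) a \<le> 24 * C"
      using contracting_quasiconvex[OF C A_contr _ _ A_mem A_mem, of _ _ _ "h u"] u(1) by blast
    have "dist (h bp) a \<le> K + 24 * C"
      using a(2) u(2) dist_triangle[of "h bp" a "h u"] isometries_dist[OF hi, of bp u]
      by (simp add: dist_commute)
    then show ?thesis using a(1) by blast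
  qed
  then show ?thesis using that by blast
qed

text \<open>If h A has unbounded projection to A, infinitely many points F m bp lie within 32C = 8C
  + 24C of h A. The elements F (- m) h F (l m) then move \<open>bp\<close> by at most 32C, so two of
  them agree by properness, and this equality is an intertwining relation.\<close>

lemma commensurating_if_unbounded:
  assumes h: "h \<in> \<Gamma>"
    and unb: "\<And>D. \<exists>n. \<exists>a\<in>nearest_pts A (h (F n bp)). dist bp a > D"
  obtains n m where "n \<noteq> 0" "m \<noteq> 0" "h \<circ> F n = F m \<circ> h"
proof -
  note hi = isom[OF h]
  define M where "M = {m. \<exists>l. dist (F m bp) (h (F l bp)) \<le> 32 * C}"
  have M_unb: "\<exists>m\<in>M. dist bp (F m bp) > D" for D
  proof -
    obtain a0 where a0: "a0 \<in> nearest_pts A (h bp)" using proj_ex .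
    obtain n a where a: "a \<in> nearest_pts A (h (F n bp))" "dist bp a > \<bar>D\<bar> + dist bp a0 + 6 * C"
      using unb by blast
    obtain S where S: "geodesic_segment (h bp) (h (F n bp)) S" using geo by blast
    have "dist a0 a > 6 * C" using a(2) dist_triangle[of bp a a0] by linarith
    then obtain u where u: "u \<in> S" "dist u a \<le> 8 * C"
      using contracting_near2[OF C A_contr S a0 a(1)] by blast
    obtain e where e: "e \<in> h ` A" "dist u e \<le> 24 * C"
      using contracting_quasiconvex[OF C contracting_image[OF A_contr hi] S u(1)] bp_A A_mem by blast
    obtain m l where ml: "a = F m bp" "e = h (F l bp)"
      using e(1) nearest_ptsD(1)[OF a(1)] by (auto simp: A_def)
    have "dist a e \<le> 32 * C" using u(2) e(2) dist_triangle[of a e u] by (simp add: dist_commute)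
    moreover have "dist bp a > D" using a(2) C zero_le_dist[of bp a0] by linarith
    ultimately show ?thesis using ml by (auto simp: M_def)
  qed
  have inf: "infinite M"
  proof
    assume "finite M"
    then have "dist bp (F m bp) \<le> Max ((\<lambda>m. dist bp (F m bp)) ` M)" if "m \<in> M" for m
      using that by simp
    then show False using M_unb by (meson not_le)
  qed
  have "\<forall>m\<in>M. \<exists>l. dist (F m bp) (h (F l bp)) \<le> 32 * C" by (simp add: M_def)
  then obtain l where l: "\<And>m. m \<in> M \<Longrightarrow> dist (F m bp) (h (F (l m) bp)) \<le> 32 * C"
    unfolding bchoice_iff by blast
  have "(\<lambda>m. F (- m) \<circ> h \<circ> F (l m)) ` M \<subseteq> {g \<in> \<Gamma>. dist bp (g bp) \<le> 32 * C}"
    using l comp F_mem h by (auto simp: F_dist_neg)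
  then have "\<not> inj_on (\<lambda>m. F (- m) \<circ> h \<circ> F (l m)) M"
    using inf finite_imageD finite_subset[OF _ proper] by blast
  then obtain m m' where m: "m \<noteq> m'" "F (- m) \<circ> h \<circ> F (l m) = F (- m') \<circ> h \<circ> F (l m')"
    unfolding inj_on_def by blast
  have eq: "h (F (l m' - l m) x) = F (m' - m) (h x)" for x
  proof -
    have "F m' (F (- m) (h (F (l m) (F (- l m) x)))) = F m' (F (- m') (h (F (l m') (F (- l m) x))))"
      using fun_cong[OF m(2), of "F (- l m) x"] by simp
    then show ?thesis by (simp add: F_comp F_zero)
  qed
  have "l m' - l m \<noteq> 0"
  proof
    assume "l m' - l m = 0"
    then have *: "F (m' - m) (h x) = h x" for x using eq[of x] by (simp add: F_zero)
    have "F (m' - m) = id"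
    proof
      fix x show "F (m' - m) x = id x" using *[of "inv_into UNIV h x"] isometriesD(5)[OF hi] by simp
    qed
    then show False using F_inj m(1) by simp
  qed
  moreover have "m' - m \<noteq> 0" using m(1) by simp
  moreover have "h \<circ> F (l m' - l m) = F (m' - m) \<circ> h" using eq by (simp add: fun_eq_iff)
  ultimately show ?thesis by (rule that)
qed

lemma finite_index_if_cobounded:
  assumes "\<And>h. h \<in> \<Gamma> \<Longrightarrow> \<exists>a\<in>A. dist (h bp) a \<le> D"
  obtains B where "finite B" "B \<subseteq> \<Gamma>" "\<And>h. h \<in> \<Gamma> \<Longrightarrow> \<exists>n. \<exists>b\<in>B. h = F n \<circ> b"
proof (rule that)
  show "finite {g \<in> \<Gamma>. dist bp (g bp) \<le> D}" by (rule proper)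
  show "{g \<in> \<Gamma>. dist bp (g bp) \<le> D} \<subseteq> \<Gamma>" by blast
  fix h assume h: "h \<in> \<Gamma>"
  obtain n where "dist (h bp) (F n bp) \<le> D" using assms[OF h] by (auto simp: A_def)
  then have "dist bp (F (- n) (h bp)) \<le> D" using F_dist_neg[of n bp "h bp"] by (simp add: dist_commute)
  moreover have "h = F n \<circ> (F (- n) \<circ> h)" by (auto simp: F_neg)
  moreover have "F (- n) \<circ> h \<in> \<Gamma>" using comp F_mem h by blast
  ultimately show "\<exists>n. \<exists>b\<in>{g \<in> \<Gamma>. dist bp (g bp) \<le> D}. h = F n \<circ> b" by (metis (mono_tags, lifting) comp_apply mem_Collect_eq)
qed

text \<open>A Behrstock inequality for A and h A, where h b is a projection of z to h A. If a is far
  from \<open>bp\<close>, the geodesic from z to h b passes near a, as h A projects to a bounded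
  part of A. Its point u near a still has h b as a projection, so b is near a projection of g a to
  A, where g is the inverse of h; and g A also has bounded projection to A.\<close>

lemma projection_dichotomy:
  assumes h: "h \<in> \<Gamma>" and nc: "\<And>n m. n \<noteq> 0 \<Longrightarrow> m \<noteq> 0 \<Longrightarrow> h \<circ> F n \<noteq> F m \<circ> h"
  obtains D where "\<And>z a b. a \<in> nearest_pts A z \<Longrightarrow> b \<in> nearest_pts A (inv_into UNIV h z) \<Longrightarrow>
    dist bp a \<le> D \<or> dist bp b \<le> D"
proof -
  note hi = isom[OF h]
  define g where "g = inv_into UNIV h"
  have g: "g \<in> \<Gamma>" and gi: "g \<in> isometries" and gh: "g (h x) = x" "h (g x) = x" for x
    using isometries_inv[OF hi] isometriesD[OF hi] inv[OF h] by (auto simp: g_def)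
  obtain D1 where D1: "\<And>n a. a \<in> nearest_pts A (h (F n bp)) \<Longrightarrow> dist bp a \<le> D1"
    using commensurating_if_unbounded[OF h] nc by (metis not_le)
  have ncg: "g \<circ> F n \<noteq> F m \<circ> g" if "n \<noteq> 0" "m \<noteq> 0" for n m
  proof
    assume eq: "g \<circ> F n = F m \<circ> g"
    have "h (F m x) = F n (h x)" for x using fun_cong[OF eq, of "h x"] gh by (metis comp_apply)
    then show False using nc[OF that(2,1)] by auto
  qed
  obtain D2 where D2: "\<And>n a. a \<in> nearest_pts A (g (F n bp)) \<Longrightarrow> dist bp a \<le> D2"
    using commensurating_if_unbounded[OF g] ncg by (metis not_le)
  define D where "D = max (D1 + 6 * C) (D2 + 24 * C)"
  have "dist bp b \<le> D" if a: "a \<in> nearest_pts A z" and b: "b \<in> nearest_pts A (g z)"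
    and far: "dist bp a > D" for z a b
  proof -
    obtain n where n: "b = F n bp" using nearest_ptsD(1)[OF b] by (auto simp: A_def)
    obtain n' where n': "a = F n' bp" using nearest_ptsD(1)[OF a] by (auto simp: A_def)
    obtain a' where a': "a' \<in> nearest_pts A (h b)" using proj_ex .
    have "dist bp a' \<le> D1" using D1 a' n by blast
    then have "dist a a' > 6 * C"
      using far dist_triangle[of bp a a'] by (simp add: D_def dist_commute)
    moreover obtain S where S: "geodesic_segment z (h b) S" using geo by blast
    ultimately obtain u where u: "u \<in> S" "dist u a \<le> 8 * C"
      using contracting_near[OF C A_contr S a a'] by blast
    have "h b \<in> nearest_pts (h ` A) z"
      using b nearest_pts_image[OF hi, of A "g z"] by (simp add: gh)
    then have "h b \<in> nearest_pts (h ` A) u"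
      by (rule nearest_pts_between) (rule geodesic_segment_dist[OF S u(1)])
    then have bu: "b \<in> nearest_pts A (g u)"
      using nearest_pts_image[OF hi, of A "g u"] isometriesD(3)[OF hi] by (auto simp: gh inj_eq)
    obtain e where e: "e \<in> nearest_pts A (g a)" using proj_ex .
    have "dist b e \<le> dist (g u) (g a) + 16 * C" by (rule proj_lipschitz[OF bu e])
    then have "dist b e \<le> 24 * C" using u(2) by (simp add: isometries_dist[OF gi])
    moreover have "dist bp e \<le> D2" using D2 e n' by blast
    ultimately show ?thesis using dist_triangle[of bp b e] by (simp add: D_def dist_commute)
  qed
  then show ?thesis using that by (metis g_def not_le)
qed

text \<open>\<open>\<phi> j\<close> describes the translate of A by F (j * N) h. The points F (j *
  N) bp are more than 2 * D apart, so the projection of z to A is within D of at most one of them;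
  for every other j the dichotomy applies after translation by F (- j * N).\<close>

lemma all_but_one_close:
  assumes h: "h \<in> \<Gamma>" and nc: "\<And>n m. n \<noteq> 0 \<Longrightarrow> m \<noteq> 0 \<Longrightarrow> h \<circ> F n \<noteq> F m \<circ> h"
  obtains D and \<phi> :: "nat \<Rightarrow> 'a \<Rightarrow> 'a" where "\<And>j. \<phi> j \<in> \<Gamma>"
    "\<And>z. \<exists>i. \<forall>j. j \<noteq> i \<longrightarrow> (\<forall>a\<in>nearest_pts A (\<phi> j z). dist bp a \<le> D)"
proof -
  obtain D where D: "\<And>z a b. a \<in> nearest_pts A z \<Longrightarrow> b \<in> nearest_pts A (inv_into UNIV h z) \<Longrightarrow>
    dist bp a \<le> D \<or> dist bp b \<le> D"
    using projection_dichotomy[OF assms] by blast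
  obtain N where N: "N > 0" "\<And>n. \<bar>n\<bar> \<ge> N \<Longrightarrow> dist bp (F n bp) > 2 * D" using F_escapes[of "2 * D"] by blast
  define \<phi> where "\<phi> j = inv_into UNIV h \<circ> F (- (int j * N))" for j :: nat
  have "\<exists>i. \<forall>j. j \<noteq> i \<longrightarrow> (\<forall>b\<in>nearest_pts A (\<phi> j z). dist bp b \<le> D)" for z
  proof -
    obtain a where a: "a \<in> nearest_pts A z" using proj_ex .
    have unique: "i = j" if "dist bp (F (- (int i * N)) a) \<le> D" "dist bp (F (- (int j * N)) a) \<le> D" for i j
    proof (rule ccontr)
      assume "i \<noteq> j"
      then have "1 \<le> \<bar>int i - int j\<bar>" by linarith
      then have "1 * N \<le> \<bar>int i - int j\<bar> * N" using N(1) by (intro mult_right_mono) auto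
      then have "N \<le> \<bar>int i * N - int j * N\<bar>" using N(1) by (simp add: abs_mult flip: left_diff_distrib)
      then have "2 * D < dist bp (F (int i * N - int j * N) bp)" by (rule N(2))
      also have "\<dots> = dist (F (int j * N) bp) (F (int i * N) bp)"
        by (simp add: F_dist_neg F_comp)
      also have "\<dots> \<le> dist (F (int j * N) bp) a + dist (F (int i * N) bp) a"
        by (metis dist_triangle2)
      also have "\<dots> \<le> 2 * D" using that by (simp add: F_dist_neg)
      finally show False by simp
    qed
    have good: "\<forall>b\<in>nearest_pts A (\<phi> j z). dist bp b \<le> D" if "dist bp (F (- (int j * N)) a) > D" for j
      using D[OF proj_F[OF a, of "- (int j * N)"]] that by (force simp: \<phi>_def)
    show ?thesis
    proof (cases "\<exists>i. dist bp (F (- (int i * N)) a) \<le> D")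
      case True
      then show ?thesis using unique good by (metis not_le)
    next
      case False
      then show ?thesis using good by (meson not_le)
    qed
  qed
  moreover have "\<phi> j \<in> \<Gamma>" for j using comp inv[OF h] F_mem by (simp add: \<phi>_def)
  ultimately show ?thesis using that by blast
qed

end

section \<open>Displacing the complement of a shadow\<close>

lemma finite_bounded_above:
  fixes f :: "'a \<Rightarrow> real"
  assumes "finite S"
  obtains B where "B \<ge> 0" "\<And>x. x \<in> S \<Longrightarrow> f x \<le> B"
proof (rule that[of "Max (insert 0 (f ` S))"])
qed (use assms in auto)

lemma isometries_inv_comp:
  assumes "g \<in> isometries" "h \<in> isometries"
  shows "inv_into UNIV (g \<circ> h) x = inv_into UNIV h (inv_into UNIV g x)"
  using o_inv_distrib[OF isometriesD(4)[OF assms(1)] isometriesD(4)[OF assms(2)]] by simp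

lemma isometries_inv_inv: "g \<in> isometries \<Longrightarrow> inv_into UNIV (inv_into UNIV g) = g"
  by (rule inv_inv_eq[OF isometriesD(4)])

context axis
begin

text \<open>The elements of \<open>H\<close> produced by the confining property at the elements \<open>g (s n)\<^sup>-\<^sup>1\<close>, where
  \<open>s n\<close> walks along the axis translated by \<open>g0\<close>, are conjugates of elements of \<open>P0\<close>.  A conjugate
  of an element of \<open>Q\<close> does what is claimed.  Otherwise all these elements of \<open>H\<close> move the base
  point by at most \<open>E\<close>; since \<open>H\<close> is discrete, two of them coincide, and this is incompatible with
  the unbounded displacement of the elements of \<open>P0\<close>.\<close>

lemma pivot:
  assumes P0: "finite P0" "P0 \<subseteq> isometries"
    and \<Delta>: "\<And>p. p \<in> P0 \<Longrightarrow> dist bp (p bp) \<le> \<Delta>"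
    and E: "E \<ge> 0"
    and small: "\<And>g p. g \<in> \<Gamma> \<Longrightarrow> \<forall>q\<in>Q. dist (g bp) (q (g bp)) > E \<Longrightarrow> p \<in> P0 - Q \<Longrightarrow>
      dist (g bp) (p (g bp)) \<le> E"
    and moved: "\<And>p. p \<in> P0 \<Longrightarrow> \<exists>v\<in>\<Gamma>. dist (v bp) (p (v bp)) > E"
    and Q: "Q \<subseteq> P0"
    and H: "finite {h \<in> H. dist bp (h bp) \<le> E}"
    and confined: "\<And>g. g \<in> \<Gamma> \<Longrightarrow> \<exists>h\<in>H. \<exists>p\<in>P0. \<forall>x. h (g x) = g (p x)"
    and g0: "g0 \<in> \<Gamma>" "\<And>q. q \<in> Q \<Longrightarrow> dist (g0 bp) (q (g0 bp)) > 48 * C + 2 * \<Delta> + 2 * D"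
      "\<And>a. a \<in> nearest_pts A (inv_into UNIV g0 bp) \<Longrightarrow> dist bp a \<le> D"
  obtains K where "\<And>g. g \<in> \<Gamma> \<Longrightarrow> \<forall>a\<in>nearest_pts A (inv_into UNIV g bp). dist bp a \<le> D \<Longrightarrow>
    \<exists>h\<in>H. dist (g bp) (h (g bp)) \<le> K \<and>
      (\<forall>w. \<forall>a\<in>nearest_pts A (inv_into UNIV g w). \<forall>b\<in>nearest_pts A (inv_into UNIV g (h w)).
        dist bp a \<le> D + 6 * C \<longrightarrow> dist bp b > D + 6 * C)"
proof -
  define g0' where "g0' = inv_into UNIV g0"
  have g0i: "g0 \<in> isometries" and g0'i: "g0' \<in> isometries"
    and g0g0': "g0 (g0' x) = x" "g0' (g0 x) = x" and g0'\<Gamma>: "g0' \<in> \<Gamma>" for x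
    using isom g0(1) inv isometriesD[of g0] by (auto simp: g0'_def)
  obtain a0 where a0: "a0 \<in> nearest_pts A (g0' bp)" using proj_ex .
  have a0D: "dist bp a0 \<le> D" using g0(3) a0 by (simp add: g0'_def)
  \<comment> \<open>The separation required by \<open>contracting_small_displacement\<close> for z =
    bp.\<close>
  define T where "T = 22 * C + \<Delta>"
  \<comment> \<open>Otherwise q displaces g0 a0, a projection of \<open>bp\<close> to the translated
    axis, by at most 48C + 2 * \<Delta>. As g0 a0 is within D of g0 bp, this contradicts the choice
    of g0.\<close>
  have star: False
    if q: "q \<in> Q" and b: "b \<in> nearest_pts A (g0' v)" and b': "b' \<in> nearest_pts A (g0' (q v))"
      and far: "dist a0 b > T" "dist a0 b' > T" for q v b b'
  proof -
    have qi: "q \<in> isometries" and q\<Delta>: "dist bp (q bp) \<le> \<Delta>" using q Q P0(2) \<Delta> by auto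
    have near: "g0 y \<in> nearest_pts (g0 ` A) x" if "y \<in> nearest_pts A (g0' x)" for x y
      using nearest_pts_image[OF g0i, of A "g0' x"] that by (simp add: g0g0')
    have "dist (g0 a0) (q (g0 a0)) \<le> 48 * C + 2 * dist bp (q bp)"
      by (rule contracting_small_displacement[OF geo C contracting_image[OF A_contr g0i] qi
            near[OF a0] near[OF b'] near[OF b]])
        (use far q\<Delta> in \<open>simp_all add: isometries_dist[OF g0i] T_def\<close>)
    moreover have "dist (g0 bp) (q (g0 bp)) \<le> dist (g0 bp) (g0 a0) + dist (g0 a0) (q (g0 a0))
        + dist (q (g0 a0)) (q (g0 bp))"
      using dist_triangle[of "g0 bp" "q (g0 bp)" "g0 a0"]
        dist_triangle[of "g0 a0" "q (g0 bp)" "q (g0 a0)"] by linarith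
    ultimately show False
      using g0(2)[OF q] a0D q\<Delta> by (simp add: isometries_dist[OF g0i] isometries_dist[OF qi] dist_commute)
  qed
  \<comment> \<open>If some q in Q moved u bp by at most E, the image would still project far from
    a0, contrary to \<open>star\<close>. So Q displaces u bp by more than E, and
    \<open>small\<close> applies to p.\<close>
  have behind: "dist (u bp) (p (u bp)) \<le> E"
    if u: "u \<in> \<Gamma>" and p: "p \<in> P0 - Q" and b: "b \<in> nearest_pts A (g0' (u bp))"
      and far: "dist a0 b > T + E + 16 * C" for u p b
  proof (rule small[OF u _ p], intro ballI, rule ccontr)
    fix q assume q: "q \<in> Q" "\<not> dist (u bp) (q (u bp)) > E"
    obtain b' where b': "b' \<in> nearest_pts A (g0' (q (u bp)))" using proj_ex .
    have "dist b b' \<le> dist (g0' (u bp)) (g0' (q (u bp))) + 16 * C" by (rule proj_lipschitz[OF b b'])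
    then have "dist b b' \<le> E + 16 * C" using q(2) by (simp add: isometries_dist[OF g0'i])
    then have "dist a0 b' > T" using far dist_triangle[of a0 b b'] by (simp add: dist_commute)
    moreover have "dist a0 b > T" using far E C by linarith
    ultimately show False using star[OF q(1) b b'] by blast
  qed
  have "\<forall>p\<in>P0. \<exists>v. v \<in> \<Gamma> \<and> dist (v bp) (p (v bp)) > E" using moved by blast
  then obtain v where v: "\<And>p. p \<in> P0 \<Longrightarrow> v p \<in> \<Gamma>" "\<And>p. p \<in> P0 \<Longrightarrow> dist (v p bp) (p (v p bp)) > E"
    unfolding bchoice_iff by blast
  obtain V where V: "V \<ge> 0" "\<And>p. p \<in> P0 \<Longrightarrow> dist (v p bp) bp \<le> V"
    using finite_bounded_above[OF P0(1), of "\<lambda>p. dist (v p bp) bp"] by blast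
  \<comment> \<open>Spacing of the positions: a nonzero multiple of M takes any axis point within D
    + V + 16C of \<open>bp\<close> more than T + E + 16C away from a0.\<close>
  obtain M where M: "M > 0"
    "\<And>n. \<bar>n\<bar> \<ge> M \<Longrightarrow> dist bp (F n bp) > T + E + 38 * C + 2 * D + V"
    using F_escapes[of "T + E + 38 * C + 2 * D + V"] by blast
  have leave: "dist a0 (F (n * M) b) > T + E + 38 * C + D + V - dist bp b" if "n \<noteq> 0" for n b
  proof -
    have "1 * M \<le> \<bar>n\<bar> * M" using that M(1) by (intro mult_right_mono) auto
    then have "\<bar>n * M\<bar> \<ge> M" using M(1) by (simp add: abs_mult)
    then have "dist bp (F (n * M) bp) > T + E + 38 * C + 2 * D + V" by (rule M(2))
    moreover have "dist bp (F (n * M) bp) \<le> dist bp a0 + dist a0 (F (n * M) b) + dist (F (n * M) b) (F (n * M) bp)"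
      using dist_triangle[of bp "F (n * M) bp" a0] dist_triangle[of a0 "F (n * M) bp" "F (n * M) b"]
      by linarith
    ultimately show ?thesis using a0D by (simp add: F_dist dist_commute)
  qed
  define s where "s n = g0 \<circ> F (int n * M)" for n
  define s' where "s' n = F (- (int n * M)) \<circ> g0'" for n
  have s\<Gamma>: "s n \<in> \<Gamma>" "s' n \<in> \<Gamma>" for n using comp F_mem g0(1) g0'\<Gamma> by (auto simp: s_def s'_def)
  have si: "s n \<in> isometries" "s' n \<in> isometries" for n using s\<Gamma> isom by auto
  have ss: "s n (s' n x) = x" "s' n (s n x) = x" for n x
    by (simp_all add: s_def s'_def F_neg g0g0')
  define N where "N = card {h \<in> H. dist bp (h bp) \<le> E}"
  \<comment> \<open>One position more than the pigeonholes; 0 is left out because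
    \<open>leave\<close> needs a nonzero multiple.\<close>
  define J where "J = {1..Suc N}"
  obtain B where B: "B \<ge> 0" "\<And>n. n \<in> J \<Longrightarrow> dist bp (s n bp) \<le> B"
    using finite_bounded_above[of J "\<lambda>n. dist bp (s n bp)"] by (auto simp: J_def)
  show ?thesis
  proof (rule that[of "\<Delta> + 2 * B"])
    fix g assume g: "g \<in> \<Gamma>" and gD: "\<forall>a\<in>nearest_pts A (inv_into UNIV g bp). dist bp a \<le> D"
    define g' where "g' = inv_into UNIV g"
    have gi: "g \<in> isometries" and gg: "g (g' x) = x" "g' (g x) = x" and g'\<Gamma>: "g' \<in> \<Gamma>" for x
      using isom[OF g] inv[OF g] isometriesD[OF isom[OF g]] by (auto simp: g'_def)
    have "\<exists>h p. h \<in> H \<and> p \<in> P0 \<and> (\<forall>x. h (g (s' n x)) = g (s' n (p x)))" for n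
      using confined[of "g \<circ> s' n"] comp[OF g s\<Gamma>(2)] by auto
    then obtain h p where hp: "\<And>n. h n \<in> H" "\<And>n. p n \<in> P0" "\<And>n x. h n (g (s' n x)) = g (s' n (p n x))"
      by metis
    have hg: "s n (g' (h n (g y))) = p n (s n y)" for n y
      using hp(3)[of n "s n y"] by (simp add: ss gg)
    have pi: "p n \<in> isometries" for n using hp(2) P0(2) by blast
    have "dist (g bp) (h n (g bp)) \<le> \<Delta> + 2 * B" if "n \<in> J" for n
    proof -
      have "dist (g bp) (h n (g bp)) = dist (g (s' n (s n bp))) (g (s' n (p n (s n bp))))"
        using hp(3)[of n "s n bp"] by (simp add: ss)
      also have "\<dots> = dist (s n bp) (p n (s n bp))" by (simp add: isometries_dist[OF gi] isometries_dist[OF si(2)])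
      also have "\<dots> \<le> dist (s n bp) bp + dist bp (p n bp) + dist (p n bp) (p n (s n bp))"
        using dist_triangle[of "s n bp" "p n (s n bp)" bp] dist_triangle[of bp "p n (s n bp)" "p n bp"]
        by linarith
      also have "\<dots> \<le> \<Delta> + 2 * B"
        using B(2)[OF that] \<Delta>[OF hp(2), of n] by (simp add: isometries_dist[OF pi] dist_commute)
      finally show ?thesis .
    qed
    moreover have "\<exists>n\<in>J. p n \<in> Q"
    proof (rule ccontr)
      assume "\<not> (\<exists>n\<in>J. p n \<in> Q)"
      then have pQ: "p n \<in> P0 - Q" if "n \<in> J" for n using that hp(2) by blast
      have "h n \<in> {h \<in> H. dist bp (h bp) \<le> E}" if n: "n \<in> J" for n
      proof -
        obtain b where b: "b \<in> nearest_pts A (g' bp)" using proj_ex .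
        have bD: "dist bp b \<le> D" using gD b by (simp add: g'_def)
        have "dist ((s n \<circ> g') bp) (p n ((s n \<circ> g') bp)) \<le> E"
        proof (rule behind)
          show "s n \<circ> g' \<in> \<Gamma>" using comp s\<Gamma> g'\<Gamma> by blast
          show "F (int n * M) b \<in> nearest_pts A (g0' ((s n \<circ> g') bp))"
            using proj_F[OF b, of "int n * M"] by (simp add: s_def g0g0')
          show "dist a0 (F (int n * M) b) > T + E + 16 * C"
            using leave[of "int n" b] n bD V(1) C by (simp add: J_def)
        qed (rule pQ[OF n])
        also have "dist ((s n \<circ> g') bp) (p n ((s n \<circ> g') bp)) = dist (s n (g' bp)) (s n (g' (h n bp)))"
          using hg[of n "g' bp"] by (simp add: gg)
        also have "\<dots> = dist bp (h n bp)"
          using isometries_dist[OF isom[OF g'\<Gamma>]] by (simp add: isometries_dist[OF si(1)])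
        finally show ?thesis using hp(1) by simp
      qed
      then have "h ` J \<subseteq> {h \<in> H. dist bp (h bp) \<le> E}" by blast
      moreover have "card J > N" by (simp add: J_def)
      ultimately have "\<not> inj_on h J" using card_inj_on_le[OF _ _ H, of h J] by (auto simp: N_def)
      then obtain n l where nl: "n \<in> J" "l \<in> J" "n \<noteq> l" "h n = h l" unfolding inj_on_def by blast
      \<comment> \<open>As h n = h l, conjugation turns the displacement of v (p l) bp under p l,
        which exceeds E, into that of u bp under p n. But u bp projects far from a0, so
        \<open>behind\<close> bounds the latter by E.\<close>
      define u where "u = s n \<circ> (s' l \<circ> v (p l))"
      obtain b where b: "b \<in> nearest_pts A (g0' (v (p l) bp))" using proj_ex .
      have "dist b a0 \<le> dist (g0' (v (p l) bp)) (g0' bp) + 16 * C" by (rule proj_lipschitz[OF b a0])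
      also have "\<dots> \<le> V + 16 * C" using V(2)[OF hp(2)] by (simp add: isometries_dist[OF g0'i])
      finally have b_bp: "dist bp b \<le> D + V + 16 * C"
        using a0D dist_triangle[of bp b a0] by (simp add: dist_commute)
      have "dist (u bp) (p n (u bp)) \<le> E"
      proof (rule behind)
        show "u \<in> \<Gamma>" unfolding u_def using comp s\<Gamma> v(1)[OF hp(2)] by blast
        show "F ((int n - int l) * M) b \<in> nearest_pts A (g0' (u bp))"
          using proj_F[OF b, of "(int n - int l) * M"]
          by (simp add: u_def s_def s'_def g0g0' F_comp algebra_simps)
        show "dist a0 (F ((int n - int l) * M) b) > T + E + 16 * C"
          using leave[of "int n - int l" b] nl(3) b_bp C by simp
      qed (rule pQ[OF nl(1)])
      moreover have "dist (u bp) (p n (u bp)) = dist (v (p l) bp) (p l (v (p l) bp))"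
      proof -
        define y where "y = s' l (v (p l) bp)"
        have sy: "s l y = v (p l) bp" "s n y = u bp" by (simp_all add: y_def ss u_def)
        have 1: "s' n (p n (u bp)) = s' l (p l (v (p l) bp))"
          using hg[of n y] hg[of l y] nl(4) sy by (metis ss(2))
        have "dist (u bp) (p n (u bp)) = dist (s' n (u bp)) (s' n (p n (u bp)))"
          by (simp add: isometries_dist[OF si(2)])
        also have "\<dots> = dist y (s' l (p l (v (p l) bp)))" unfolding 1 using sy ss(2) by metis
        also have "\<dots> = dist (v (p l) bp) (p l (v (p l) bp))"
          by (simp add: y_def isometries_dist[OF si(2)])
        finally show ?thesis .
      qed
      ultimately show False using v(2)[OF hp(2), of l] by simp
    qed
    \<comment> \<open>If w and h n w both projected near the base point, s n would carry them, after
      g', to a point and its image under p n \<in> Q, both projecting far from a0;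
      \<open>star\<close> forbids this.\<close>
    then obtain n where n: "n \<in> J" "p n \<in> Q" by blast
    have "dist bp b > D + 6 * C"
      if a: "a \<in> nearest_pts A (g' w)" and b: "b \<in> nearest_pts A (g' (h n w))"
        and aD: "dist bp a \<le> D + 6 * C" for w a b
    proof (rule ccontr)
      assume bD: "\<not> dist bp b > D + 6 * C"
      show False
      proof (rule star[OF n(2)])
        show "F (int n * M) a \<in> nearest_pts A (g0' (s n (g' w)))"
          using proj_F[OF a, of "int n * M"] by (simp add: s_def g0g0')
        have "p n (s n (g' w)) = s n (g' (h n w))" using hg[of n "g' w"] by (simp add: gg)
        then show "F (int n * M) b \<in> nearest_pts A (g0' (p n (s n (g' w))))"
          using proj_F[OF b, of "int n * M"] by (simp add: s_def g0g0')
        show "dist a0 (F (int n * M) a) > T" "dist a0 (F (int n * M) b) > T"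
          using leave[of "int n" a] leave[of "int n" b] n(1) aD bD V(1) C E by (simp_all add: J_def)
      qed
    qed
    ultimately show "\<exists>h\<in>H. dist (g bp) (h (g bp)) \<le> \<Delta> + 2 * B \<and>
      (\<forall>w. \<forall>a\<in>nearest_pts A (inv_into UNIV g w). \<forall>b\<in>nearest_pts A (inv_into UNIV g (h w)).
        dist bp a \<le> D + 6 * C \<longrightarrow> dist bp b > D + 6 * C)"
      using hp(1) n(1) unfolding g'_def[symmetric] by blast
  qed
qed

text \<open>The empty set qualifies, so a maximal Q exists. Adding p to Q fails at some threshold e
  p: wherever all of Q is displaced by more than e p, the displacement by p is at most e p. E is a
  common threshold.\<close>

lemma simultaneously_displaced_subset:
  assumes "finite P0"
  obtains Q E where "Q \<subseteq> P0" "E \<ge> 0"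
    "\<And>e. \<exists>g\<in>\<Gamma>. \<forall>q\<in>Q. dist (g bp) (q (g bp)) > e"
    "\<And>g p. g \<in> \<Gamma> \<Longrightarrow> \<forall>q\<in>Q. dist (g bp) (q (g bp)) > E \<Longrightarrow> p \<in> P0 - Q \<Longrightarrow>
      dist (g bp) (p (g bp)) \<le> E"
proof -
  define \<Q> where "\<Q> = {Q. Q \<subseteq> P0 \<and> (\<forall>e. \<exists>g\<in>\<Gamma>. \<forall>q\<in>Q. dist (g bp) (q (g bp)) > e)}"
  have "finite \<Q>" using assms by (auto simp: \<Q>_def intro: finite_subset[of _ "Pow P0"])
  moreover have "{} \<in> \<Q>" using F_mem by (auto simp: \<Q>_def)
  ultimately obtain Q where Q: "Q \<in> \<Q>" "\<And>Q'. Q' \<in> \<Q> \<Longrightarrow> Q \<subseteq> Q' \<Longrightarrow> Q = Q'"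
    using finite_has_maximal[of \<Q>] by blast
  have "\<forall>p\<in>P0 - Q. \<exists>e. \<forall>g\<in>\<Gamma>. (\<forall>q\<in>Q. dist (g bp) (q (g bp)) > e) \<longrightarrow> dist (g bp) (p (g bp)) \<le> e"
  proof
    fix p assume p: "p \<in> P0 - Q"
    then have "insert p Q \<notin> \<Q>" using Q(2)[of "insert p Q"] by blast
    moreover have "insert p Q \<subseteq> P0" using p Q(1) by (auto simp: \<Q>_def)
    ultimately obtain e where "\<forall>g\<in>\<Gamma>. \<exists>q\<in>insert p Q. \<not> dist (g bp) (q (g bp)) > e"
      by (auto simp: \<Q>_def)
    then show "\<exists>e. \<forall>g\<in>\<Gamma>. (\<forall>q\<in>Q. dist (g bp) (q (g bp)) > e) \<longrightarrow> dist (g bp) (p (g bp)) \<le> e"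
      by (intro exI[of _ e]) force
  qed
  then obtain e where e: "\<And>p g. p \<in> P0 - Q \<Longrightarrow> g \<in> \<Gamma> \<Longrightarrow> \<forall>q\<in>Q. dist (g bp) (q (g bp)) > e p \<Longrightarrow>
      dist (g bp) (p (g bp)) \<le> e p"
    unfolding bchoice_iff by blast
  obtain E where E: "E \<ge> 0" "\<And>p. p \<in> P0 - Q \<Longrightarrow> e p \<le> E"
    using finite_bounded_above[of "P0 - Q" e] assms by blast
  show ?thesis
  proof (rule that[of Q E])
    fix g p assume "g \<in> \<Gamma>" "\<forall>q\<in>Q. dist (g bp) (q (g bp)) > E" "p \<in> P0 - Q"
    then show "dist (g bp) (p (g bp)) \<le> E" using e[of p g] E(2)[of p] by force
  qed (use Q(1) E(1) in \<open>auto simp: \<Q>_def\<close>)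
qed

text \<open>On the axis k A with k = g \<psi> j, every point outside the cone projects close to k
  bp, while the h supplied by \<open>pivot\<close> never keeps both w and h w projecting
  there.\<close>

lemma shadow_complement_displaced:
  assumes h0: "h0 \<in> \<Gamma>" "\<And>n m. n \<noteq> 0 \<Longrightarrow> m \<noteq> 0 \<Longrightarrow> h0 \<circ> F n \<noteq> F m \<circ> h0"
    and P0: "finite P0" "P0 \<subseteq> isometries"
    and moved: "\<And>p E. p \<in> P0 \<Longrightarrow> \<exists>v\<in>\<Gamma>. dist (v bp) (p (v bp)) > E"
    and H: "H \<subseteq> isometries" "\<And>R. finite {h \<in> H. dist bp (h bp) \<le> R}"
    and confined: "\<And>g. g \<in> \<Gamma> \<Longrightarrow> \<exists>h\<in>H. \<exists>p\<in>P0. \<forall>x. h (g x) = g (p x)"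
  obtains K r0 where "r0 > 0"
    "\<And>g x r. g \<in> \<Gamma> \<Longrightarrow> r \<ge> r0 \<Longrightarrow> \<exists>h\<in>H. dist (g bp) (h (g bp)) \<le> K \<and>
       (\<forall>w. w \<notin> cone x (ball (g bp) r) \<longrightarrow> h w \<in> cone x (ball (g bp) r))"
proof -
  obtain D and \<phi> :: "nat \<Rightarrow> 'a \<Rightarrow> 'a" where \<phi>: "\<And>j. \<phi> j \<in> \<Gamma>"
    and one: "\<And>z. \<exists>i. \<forall>j. j \<noteq> i \<longrightarrow> (\<forall>a\<in>nearest_pts A (\<phi> j z). dist bp a \<le> D)"
    by (rule all_but_one_close[OF h0]) (assumption+, rule that)
  obtain Q E where Q: "Q \<subseteq> P0" and E: "E \<ge> 0"
    and Q_unb: "\<And>e. \<exists>g\<in>\<Gamma>. \<forall>q\<in>Q. dist (g bp) (q (g bp)) > e"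
    and small: "\<And>g p. g \<in> \<Gamma> \<Longrightarrow> \<forall>q\<in>Q. dist (g bp) (q (g bp)) > E \<Longrightarrow> p \<in> P0 - Q \<Longrightarrow>
      dist (g bp) (p (g bp)) \<le> E"
    using simultaneously_displaced_subset[OF P0(1)] by blast
  define \<psi> where "\<psi> j = inv_into UNIV (\<phi> j)" for j
  have \<psi>: "\<psi> j \<in> \<Gamma>" "inv_into UNIV (\<psi> j) = \<phi> j" for j
    using \<phi> inv isometries_inv_inv[OF isom] by (auto simp: \<psi>_def)
  obtain \<Delta> where \<Delta>: "\<And>p. p \<in> P0 \<Longrightarrow> dist bp (p bp) \<le> \<Delta>"
    using finite_bounded_above[OF P0(1), of "\<lambda>p. dist bp (p bp)"] by blast
  obtain B where B: "B \<ge> 0" "\<And>j. j < 4 \<Longrightarrow> dist bp (\<psi> j bp) \<le> B"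
    using finite_bounded_above[of "{..<4::nat}" "\<lambda>j. dist bp (\<psi> j bp)"] by auto
  \<comment> \<open>The summand 2 * B pays for passing from g0 to g0 \<circ> \<psi> j.\<close>
  obtain g0 where g0: "g0 \<in> \<Gamma>"
    and g0Q: "\<forall>q\<in>Q. dist (g0 bp) (q (g0 bp)) > 48 * C + 2 * \<Delta> + 2 * D + 2 * B"
    using Q_unb by blast
  define close where "close z j \<longleftrightarrow> (\<forall>a\<in>nearest_pts A (\<phi> j z). dist bp a \<le> D)" for z j
  define pivots where "pivots K j \<longleftrightarrow> (\<forall>g\<in>\<Gamma>.
    (\<forall>a\<in>nearest_pts A (inv_into UNIV g bp). dist bp a \<le> D) \<longrightarrow>
    (\<exists>h\<in>H. dist (g bp) (h (g bp)) \<le> K \<and>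
      (\<forall>w. \<forall>a\<in>nearest_pts A (inv_into UNIV g w). \<forall>b\<in>nearest_pts A (inv_into UNIV g (h w)).
        dist bp a \<le> D + 6 * C \<longrightarrow> dist bp b > D + 6 * C)))" for K and j :: nat
  \<comment> \<open>The index j will depend on g and x, which are not yet fixed; recording one
    constant for each admissible j < 4 keeps the final bound uniform.\<close>
  have "\<exists>K. close (inv_into UNIV g0 bp) j \<and> j < 4 \<longrightarrow> pivots K j" for j
  proof (cases "close (inv_into UNIV g0 bp) j \<and> j < 4")
    case True
    have i: "g0 \<in> isometries" "\<psi> j \<in> isometries" using g0 \<psi>(1) isom by auto
    have far: "dist ((g0 \<circ> \<psi> j) bp) (q ((g0 \<circ> \<psi> j) bp)) > 48 * C + 2 * \<Delta> + 2 * D" if q: "q \<in> Q" for q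
    proof -
      have qi: "q \<in> isometries" using q Q P0(2) by blast
      have "dist (g0 bp) (q (g0 bp)) \<le> dist (g0 bp) (g0 (\<psi> j bp)) + dist (g0 (\<psi> j bp)) (q (g0 (\<psi> j bp)))
          + dist (q (g0 (\<psi> j bp))) (q (g0 bp))"
        using dist_triangle[of "g0 bp" "q (g0 bp)" "g0 (\<psi> j bp)"]
          dist_triangle[of "g0 (\<psi> j bp)" "q (g0 bp)" "q (g0 (\<psi> j bp))"] by linarith
      then show ?thesis
        using g0Q q True B(2)[of j] by (force simp: isometries_dist[OF i(1)] isometries_dist[OF qi] dist_commute)
    qed
    have near: "dist bp a \<le> D" if "a \<in> nearest_pts A (inv_into UNIV (g0 \<circ> \<psi> j) bp)" for a
      using True that unfolding isometries_inv_comp[OF i] \<psi>(2) by (simp add: close_def)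
    note k = comp[OF g0 \<psi>(1)[of j]]
    have "\<exists>K. pivots K j"
    proof (rule pivot[where ?P0.0 = P0 and \<Delta> = \<Delta> and E = E and Q = Q and H = H and D = D
            and ?g0.0 = "g0 \<circ> \<psi> j"])
      fix K
      assume "\<And>g. g \<in> \<Gamma> \<Longrightarrow> \<forall>a\<in>nearest_pts A (inv_into UNIV g bp). dist bp a \<le> D \<Longrightarrow>
        \<exists>h\<in>H. dist (g bp) (h (g bp)) \<le> K \<and>
          (\<forall>w. \<forall>a\<in>nearest_pts A (inv_into UNIV g w). \<forall>b\<in>nearest_pts A (inv_into UNIV g (h w)).
            dist bp a \<le> D + 6 * C \<longrightarrow> dist bp b > D + 6 * C)"
      then show "\<exists>K. pivots K j" unfolding pivots_def by blast
    qed (fact P0 \<Delta> E small moved Q H(2) confined k far near)+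
    then show ?thesis by blast
  qed (use F_mem in blast)
  then obtain K where K: "\<And>j. close (inv_into UNIV g0 bp) j \<Longrightarrow> j < 4 \<Longrightarrow> pivots (K j) j" by metis
  obtain KB where KB: "\<And>j. j < 4 \<Longrightarrow> K j \<le> KB"
    using finite_bounded_above[of "{..<4::nat}" K] by auto
  show ?thesis
  \<comment> \<open>8C + D bounds the distance from k bp to the geodesic point near the projection
    of x, and B that from g bp to k bp; the last 1 places this point in the open ball.\<close>
  proof (rule that[of "max 1 (8 * C + D + B + 1)" "KB + 2 * B"])
    fix g x r assume g: "g \<in> \<Gamma>" and r: "r \<ge> max 1 (8 * C + D + B + 1)"
    define g' where "g' = inv_into UNIV g"
    obtain i1 where i1: "\<And>j. j \<noteq> i1 \<Longrightarrow> close (inv_into UNIV g0 bp) j" using one close_def by metis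
    obtain i2 where i2: "\<And>j. j \<noteq> i2 \<Longrightarrow> close (g' x) j" using one close_def by metis
    obtain i3 where i3: "\<And>j. j \<noteq> i3 \<Longrightarrow> close (g' bp) j" using one close_def by metis
    have "\<exists>j<4. j \<noteq> i1 \<and> j \<noteq> i2 \<and> j \<noteq> i3" by presburger
    then obtain j where j: "j < 4" "close (inv_into UNIV g0 bp) j" "close (g' x) j" "close (g' bp) j"
      using i1 i2 i3 by blast
    define k where "k = g \<circ> \<psi> j"
    have k\<Gamma>: "k \<in> \<Gamma>" using comp[OF g \<psi>(1)] by (simp add: k_def)
    have ki: "k \<in> isometries" "inv_into UNIV k y = \<phi> j (g' y)" for y
      using isom[OF k\<Gamma>] isometries_inv_comp[OF isom[OF g] isom[OF \<psi>(1)], of j y]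
      by (auto simp: k_def \<psi>(2) g'_def)
    have kg: "dist (g bp) (k bp) \<le> B"
      using B(2)[OF j(1)] by (simp add: k_def isometries_dist[OF isom[OF g]])
    have "\<exists>h\<in>H. dist (k bp) (h (k bp)) \<le> K j \<and>
      (\<forall>w. \<forall>a\<in>nearest_pts A (\<phi> j (g' w)). \<forall>b\<in>nearest_pts A (\<phi> j (g' (h w))).
        dist bp a \<le> D + 6 * C \<longrightarrow> dist bp b > D + 6 * C)"
      using K[OF j(2,1)] k\<Gamma> j(4) unfolding pivots_def close_def ki(2)[symmetric] by blast
    then obtain h where h: "h \<in> H" "dist (k bp) (h (k bp)) \<le> K j"
      "\<And>w a b. a \<in> nearest_pts A (\<phi> j (g' w)) \<Longrightarrow> b \<in> nearest_pts A (\<phi> j (g' (h w))) \<Longrightarrow>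
        dist bp a \<le> D + 6 * C \<Longrightarrow> dist bp b > D + 6 * C"
      by blast
    have hi: "h \<in> isometries" using h(1) H(1) by blast
    \<comment> \<open>A far projection of w would force the geodesic from x to w past the projection
      of x, hence through the ball.\<close>
    have near: "dist bp a \<le> D + 6 * C"
      if w: "w \<notin> cone x (ball (g bp) r)" and a: "a \<in> nearest_pts A (\<phi> j (g' w))" for w a
    proof (rule ccontr)
      assume far: "\<not> dist bp a \<le> D + 6 * C"
      obtain e where e: "e \<in> nearest_pts A (\<phi> j (g' x))" using proj_ex .
      have eD: "dist bp e \<le> D" using j(3) e by (simp add: close_def)
      obtain S where S: "geodesic_segment (\<phi> j (g' x)) (\<phi> j (g' w)) S" using geo by blast
      have "dist e a > 6 * C" using far eD dist_triangle[of bp a e] by linarith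
      then obtain u where u: "u \<in> S" "dist u e \<le> 8 * C"
        using contracting_near[OF C A_contr S e a] by blast
      have "k (\<phi> j (g' y)) = y" for y using isometriesD(5)[OF ki(1), of y] by (simp add: ki(2))
      then have "geodesic_segment x w (k ` S)" using geodesic_segment_image[OF S ki(1)] by simp
      moreover have "k u \<in> ball (g bp) r"
      proof -
        have "dist bp u \<le> 8 * C + D" using u(2) eD dist_triangle[of bp u e] by (simp add: dist_commute)
        then have "dist (g bp) (k u) \<le> B + (8 * C + D)"
          using kg dist_triangle[of "g bp" "k u" "k bp"] by (simp add: isometries_dist[OF ki(1)])
        then show ?thesis using r by simp
      qed
      ultimately show False using w u(1) unfolding cone_def by blast
    qed
    have "h w \<in> cone x (ball (g bp) r)" if w: "w \<notin> cone x (ball (g bp) r)" for w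
    proof (rule ccontr)
      assume hw: "h w \<notin> cone x (ball (g bp) r)"
      obtain a b where ab: "a \<in> nearest_pts A (\<phi> j (g' w))" "b \<in> nearest_pts A (\<phi> j (g' (h w)))"
        using proj_ex by metis
      show False using h(3)[OF ab near[OF w ab(1)]] near[OF hw ab(2)] by simp
    qed
    moreover have "dist (g bp) (h (g bp)) \<le> KB + 2 * B"
    proof -
      have "dist (g bp) (h (g bp)) \<le> dist (g bp) (k bp) + dist (k bp) (h (k bp)) + dist (h (k bp)) (h (g bp))"
        using dist_triangle[of "g bp" "h (g bp)" "k bp"] dist_triangle[of "k bp" "h (g bp)" "h (k bp)"]
        by linarith
      then show ?thesis
        using kg h(2) KB[OF j(1)] by (simp add: isometries_dist[OF hi] dist_commute)
    qed
    ultimately show "\<exists>h\<in>H. dist (g bp) (h (g bp)) \<le> KB + 2 * B \<and>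
       (\<forall>w. w \<notin> cone x (ball (g bp) r) \<longrightarrow> h w \<in> cone x (ball (g bp) r))"
      using h(1) by blast
  qed simp
qed

end

section \<open>Non-elementary groups\<close>

context axis
begin

text \<open>The cosets of the infinite cyclic group \<open>range F\<close> are represented by
  elements that move \<open>bp\<close> by at most D, of which there are finitely many.\<close>

lemma elementary_if_cobounded:
  assumes sub: "subgroup \<Gamma> isom_group" and "\<And>h. h \<in> \<Gamma> \<Longrightarrow> \<exists>a\<in>A. dist (h bp) a \<le> D"
  shows "elementary_group (isom_group\<lparr>carrier := \<Gamma>\<rparr>)"
proof -
  let ?G = "isom_group\<lparr>carrier := \<Gamma>\<rparr>" and ?K = "range F"
  obtain B where B: "finite B" "B \<subseteq> \<Gamma>" "\<And>h. h \<in> \<Gamma> \<Longrightarrow> \<exists>n. \<exists>b\<in>B. h = F n \<circ> b"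
    by (rule finite_index_if_cobounded, erule assms(2)) (rule that)
  have grp: "group ?G" using subgroup.subgroup_is_group[OF sub group_isom_group] .
  have inv_F: "inv\<^bsub>?G\<^esub> (F n) = F (- n)" for n
  proof (rule group.inv_equality[OF grp])
    show "F (- n) \<otimes>\<^bsub>?G\<^esub> F n = \<one>\<^bsub>?G\<^esub>" by (simp add: isom_group_def fun_eq_iff F_neg)
  qed (simp_all add: F_mem)
  have K: "subgroup ?K ?G"
  proof (rule group.subgroupI[OF grp])
    show "?K \<subseteq> carrier ?G" "?K \<noteq> {}" using F_mem by auto
    show "inv\<^bsub>?G\<^esub> a \<in> ?K" if "a \<in> ?K" for a using that inv_F by auto
    show "a \<otimes>\<^bsub>?G\<^esub> b \<in> ?K" if "a \<in> ?K" "b \<in> ?K" for a b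
      using that by (auto simp: isom_group_def simp flip: F_add)
  qed
  have coset: "?K #>\<^bsub>?G\<^esub> a = {F n \<circ> a |n. True}" for a
    by (auto simp: r_coset_def isom_group_def)
  have shift: "{F n \<circ> (F k \<circ> b) |n. True} = {F n \<circ> b |n. True}" for k b
  proof -
    have "F n \<circ> (F k \<circ> b) = F (n + k) \<circ> b" "F n \<circ> b = F (n - k) \<circ> (F k \<circ> b)" for n
      by (auto simp: F_comp)
    then show ?thesis by blast
  qed
  have "rcosets\<^bsub>?G\<^esub> ?K \<subseteq> (\<lambda>b. {F n \<circ> b |n. True}) ` B"
  proof
    fix R assume "R \<in> rcosets\<^bsub>?G\<^esub> ?K"
    then obtain h where h: "h \<in> \<Gamma>" "R = {F n \<circ> h |n. True}"
      unfolding RCOSETS_def coset by auto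
    obtain k b where b: "b \<in> B" "h = F k \<circ> b" using B(3)[OF h(1)] by blast
    have "R = {F n \<circ> b |n. True}" unfolding h(2) b(2) by (rule shift)
    then show "R \<in> (\<lambda>b. {F n \<circ> b |n. True}) ` B" using b(1) by (rule image_eqI)
  qed
  then have fin: "finite (rcosets\<^bsub>?G\<^esub> ?K)" using B(1) finite_surj by blast
  have "inj F"
  proof (rule injI)
    fix m n assume "F m = F n"
    then have "F (m - n) = id" by (auto simp: fun_eq_iff F_neg diff_conv_add_uminus F_add simp del: add_uminus_conv_diff)
    then show "m = n" using F_inj by simp
  qed
  then have "F \<in> iso integer_group (?G\<lparr>carrier := ?K\<rparr>)"
    by (auto simp: iso_def hom_def bij_betw_def isom_group_def integer_group_def F_add)
  then have "?G\<lparr>carrier := ?K\<rparr> \<cong> integer_group"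
    using group.iso_sym[OF group_integer_group] is_isoI by blast
  then show ?thesis unfolding elementary_group_def using K fin by blast
qed

text \<open>The D of \<open>commensurating_near\<close> is common to all commensurating elements.
  Were there no others, the whole orbit of \<open>bp\<close> would stay D-close to the axis and
  \<Gamma> would be elementary.\<close>

lemma not_commensurating:
  assumes "subgroup \<Gamma> isom_group" "\<not> elementary_group (isom_group\<lparr>carrier := \<Gamma>\<rparr>)"
  shows "\<exists>h\<in>\<Gamma>. \<forall>n m. n \<noteq> 0 \<longrightarrow> m \<noteq> 0 \<longrightarrow> h \<circ> F n \<noteq> F m \<circ> h"
proof -
  obtain D where D: "\<And>h n m. h \<in> \<Gamma> \<Longrightarrow> n \<noteq> 0 \<Longrightarrow> h \<circ> F n = F m \<circ> h \<Longrightarrow> \<exists>a\<in>A. dist (h bp) a \<le> D"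
    using commensurating_near by blast
  have "\<exists>h\<in>\<Gamma>. \<not> (\<exists>a\<in>A. dist (h bp) a \<le> D)"
    using elementary_if_cobounded[OF assms(1), of D] assms(2) by blast
  then obtain h where h: "h \<in> \<Gamma>" "\<not> (\<exists>a\<in>A. dist (h bp) a \<le> D)" by blast
  then have "h \<circ> F n \<noteq> F m \<circ> h" if "n \<noteq> 0" for n m using D[OF h(1) that, of m] by blast
  then show ?thesis using h(1) by blast
qed

end

lemma axis_of_contracting_isometry:
  fixes bp :: "'a::heine_borel"
  assumes geo: "\<And>x y :: 'a. \<exists>S. geodesic_segment x y S"
    and \<Gamma>: "subgroup \<Gamma> isom_group" "discrete \<Gamma>"
    and f: "f \<in> \<Gamma>" "contracting_isometry bp f"
  obtains C c where "axis bp \<Gamma> (\<lambda>n. f [^]\<^bsub>isom_group\<^esub> n) C c"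
proof -
  define F where "F = (\<lambda>n::int. f [^]\<^bsub>isom_group\<^esub> n)"
  obtain C where "contracting C (range (\<lambda>n. F n bp))"
    using f(2) by (auto simp: contracting_isometry_def F_def)
  \<comment> \<open>The constant is made positive, as geodesics are cut into pieces of length
    2C.\<close>
  then have C: "contracting (max 1 C) (range (\<lambda>n. F n bp))" by (rule contracting_mono) simp
  obtain c where c: "c \<ge> 1" "\<And>s t. s \<in> \<int> \<Longrightarrow> t \<in> \<int> \<Longrightarrow> dist s t / c - c \<le> dist (F \<lfloor>s\<rfloor> bp) (F \<lfloor>t\<rfloor> bp)
     \<and> dist (F \<lfloor>s\<rfloor> bp) (F \<lfloor>t\<rfloor> bp) \<le> c * dist s (t::real) + c"
    using f(2) unfolding contracting_isometry_def qi_embedding_on_def F_def by blast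
  have qi: "real_of_int \<bar>m - n\<bar> / c - c \<le> dist (F m bp) (F n bp)"
    "dist (F m bp) (F n bp) \<le> c * real_of_int \<bar>m - n\<bar> + c" for m n
    using c(2)[of "of_int m" "of_int n"] by (simp_all add: dist_real_def)
  have mem: "F n \<in> \<Gamma>" for n
    unfolding F_def by (rule group.subgroup_int_pow_closed[OF group_isom_group \<Gamma>(1) f(1)])
  have "F (m + n) = F m \<circ> F n" for m n
  proof -
    have "f \<in> carrier isom_group" using isom_subgroupD(1)[OF \<Gamma>(1)] f(1) by (auto simp: isom_group_def)
    then show ?thesis
      using group.int_pow_mult[OF group_isom_group, of f m n] by (simp add: F_def isom_group_def)
  qed
  then have "axis bp \<Gamma> F (max 1 C) c"
    using geo isom_subgroupD[OF \<Gamma>(1)] finite_discrete_isometries[OF \<Gamma>] mem C c(1) qi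
    by unfold_locales auto
  then show ?thesis using that unfolding F_def by blast
qed

section \<open>Displacement and the elliptic radical\<close>

lemma
  assumes "compactification emb"
  shows compactification_continuous: "continuous_on UNIV emb"
    and compactification_open: "open (range emb)"
    and compactification_dense: "closure (range emb) = UNIV"
proof -
  have e: "homeomorphic_map euclidean (top_of_set (range emb)) emb"
    using assms by (simp add: compactification_def embedding_map_def)
  show "continuous_on UNIV emb"
    using homeomorphic_imp_continuous_map[OF e] by (simp add: continuous_map_in_subtopology)
qed (use assms in \<open>auto simp: compactification_def\<close>)

lemma
  assumes "extends_action emb act" "g \<in> isometries"
  shows act_emb: "act g (emb x) = emb (g x)"
    and act_continuous: "continuous_on UNIV (act g)"
    and act_inj: "inj (act g)"
    and act_open: "open U \<Longrightarrow> open (act g ` U)"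
proof -
  have e: "homeomorphic_map euclidean euclidean (act g)"
    using assms by (simp add: extends_action_def)
  show "act g (emb x) = emb (g x)" using assms by (simp add: extends_action_def)
  show "continuous_on UNIV (act g)" using homeomorphic_imp_continuous_map[OF e] by simp
  show "inj (act g)" using homeomorphic_imp_injective_map[OF e] by simp
  show "open (act g ` U)" if "open U"
    using homeomorphic_imp_open_map[OF e] that by (simp add: open_map_def)
qed

text \<open>\<open>extends_action\<close> ties \<open>act\<close> to composition only on X. The set
  where the two maps cancel is closed and contains the dense image of X.\<close>

lemma act_inv:
  assumes emb: "compactification emb" and act: "extends_action emb act" and g: "g \<in> isometries"
  shows "act g (act (inv_into UNIV g) \<xi>) = \<xi>" "act (inv_into UNIV g) (act g \<xi>) = \<xi>"
proof -
  have aux: "act h (act k \<xi>) = \<xi>"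
    if h: "h \<in> isometries" and k: "k \<in> isometries" and hk: "\<And>x. h (k x) = x" for h k \<xi>
  proof -
    have "closed {\<xi>. act h (act k \<xi>) = \<xi>}"
      by (intro closed_Collect_eq continuous_on_compose2[OF act_continuous[OF act h] act_continuous[OF act k]]
          continuous_on_id) auto
    moreover have "range emb \<subseteq> {\<xi>. act h (act k \<xi>) = \<xi>}"
      by (auto simp: act_emb[OF act h] act_emb[OF act k] hk)
    ultimately have "closure (range emb) \<subseteq> {\<xi>. act h (act k \<xi>) = \<xi>}" by (rule closure_minimal[rotated])
    then show ?thesis using compactification_dense[OF emb] by auto
  qed
  show "act g (act (inv_into UNIV g) \<xi>) = \<xi>" "act (inv_into UNIV g) (act g \<xi>) = \<xi>"
    using aux g isometries_inv[OF g] isometriesD[OF g] by auto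
qed

text \<open>The image of a closed ball is compact, hence closed, and misses the boundary.\<close>

lemma escapes_if_tendsto_boundary:
  fixes x :: "nat \<Rightarrow> 'a::heine_borel"
  assumes emb: "compactification emb" and lim: "(\<lambda>n. emb (x n)) \<longlonglongrightarrow> \<xi>" and \<xi>: "\<xi> \<in> bdry emb"
  shows "filterlim (\<lambda>n. dist bp (x n)) at_top sequentially"
  unfolding filterlim_at_top
proof
  fix R
  have "compact (emb ` cball bp R)"
    by (rule compact_continuous_image[OF continuous_on_subset[OF compactification_continuous[OF emb]]]) auto
  then have "open (- emb ` cball bp R)" by (simp add: compact_imp_closed open_Compl)
  moreover have "\<xi> \<in> - emb ` cball bp R" using \<xi> by (auto simp: bdry_def)
  ultimately have "\<forall>\<^sub>F n in sequentially. emb (x n) \<in> - emb ` cball bp R"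
    by (rule topological_tendstoD[OF lim])
  then show "\<forall>\<^sub>F n in sequentially. R \<le> dist bp (x n)"
  proof (rule eventually_mono)
    fix n assume "emb (x n) \<in> - emb ` cball bp R"
    then have "x n \<notin> cball bp R" by blast
    then show "R \<le> dist bp (x n)" by simp
  qed
qed

lemma contracting_pair:
  assumes "dist a b \<le> E"
  shows "contracting E {a, b}"
proof -
  have "diameter (nearest_pts {a, b} x \<union> nearest_pts {a, b} y) \<le> E" for x y
  proof -
    have E: "0 \<le> E" using assms zero_le_dist order_trans by blast
    have sub: "nearest_pts {a, b} x \<union> nearest_pts {a, b} y \<subseteq> {a, b}" by (auto simp: nearest_pts_def)
    have d: "dist u v \<le> E"
      if "u \<in> nearest_pts {a, b} x \<union> nearest_pts {a, b} y" "v \<in> nearest_pts {a, b} x \<union> nearest_pts {a, b} y" for u v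
    proof -
      have "u \<in> {a, b}" "v \<in> {a, b}" using that sub by blast+
      then show ?thesis using assms E by (auto simp: dist_commute)
    qed
    show ?thesis
    proof (cases "nearest_pts {a, b} x \<union> nearest_pts {a, b} y = {}")
      case False
      then show ?thesis unfolding diameter_def using d by (auto intro!: cSUP_least)
    qed (simp add: E)
  qed
  then show ?thesis by (simp add: contracting_def)
qed

text \<open>A quasi-geodesic may jump: the parametrization is \<open>a\<close> at 0 and
  \<open>b\<close> elsewhere. Its constant grows with \<open>dist a b\<close>, which is harmless
  because \<open>cones_converge\<close> fixes the contraction constant only.\<close>

lemma quasi_geodesic_pair: "quasi_geodesic {a, b}"
proof -
  define p where "p t = (if t = 0 then a else b)" for t :: real
  have "qi_embedding_on {0..1} p"
    unfolding qi_embedding_on_def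
  proof (intro exI[of _ "1 + dist a b"] conjI ballI)
    fix s t :: real assume st: "s \<in> {0..1}" "t \<in> {0..1}"
    have d: "dist s t \<le> 1" using st by (auto simp: dist_real_def)
    have "dist s t / (1 + dist a b) \<le> dist s t / 1" by (rule divide_left_mono) (auto intro: add_pos_nonneg)
    then show "dist s t / (1 + dist a b) - (1 + dist a b) \<le> dist (p s) (p t)"
      using d zero_le_dist[of a b] zero_le_dist[of "p s" "p t"] by linarith
    have "dist (p s) (p t) \<le> dist a b" by (auto simp: p_def dist_commute)
    moreover have "0 \<le> (1 + dist a b) * dist s t" by simp
    ultimately show "dist (p s) (p t) \<le> (1 + dist a b) * dist s t + (1 + dist a b)" by linarith
  qed simp
  moreover have "{a, b} = p ` {0..1}"
  proof
    have "a = p 0" "b = p 1" by (auto simp: p_def)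
    then show "{a, b} \<subseteq> p ` {0..1}" by (auto intro!: imageI simp del: image_eqI)
  qed (auto simp: p_def)
  ultimately show ?thesis unfolding quasi_geodesic_def
    by (intro exI[of _ "{0..1}"] exI[of _ p]) (auto simp: is_interval_cc)
qed

text \<open>Two sequences at bounded distance have the same limit class: assumption (B) applies to the
  sequence of pairs \<open>{x n, y n}\<close>, since a set of diameter at most \<open>E\<close> is an \<open>E\<close>-contracting
  quasi-geodesic.\<close>

lemma bounded_distance_same_class:
  fixes x y :: "nat \<Rightarrow> 'a::heine_borel"
  assumes geo: "\<And>x y :: 'a. \<exists>S. geodesic_segment x y S"
    and emb: "compactification emb" and cones: "cones_converge bp emb R" and R: "equiv (bdry emb) R"
    and x: "(\<lambda>n. emb (x n)) \<longlonglongrightarrow> \<xi>" and y: "(\<lambda>n. emb (y n)) \<longlonglongrightarrow> \<eta>" and \<xi>: "\<xi> \<in> bdry emb"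
    and E: "\<And>n. dist (x n) (y n) \<le> E"
  shows "(\<xi>, \<eta>) \<in> R"
proof -
  define Z where "Z n = {x n, y n}" for n
  have far: "filterlim (\<lambda>n. - E + dist bp (x n)) at_top sequentially"
    by (rule filterlim_tendsto_add_at_top[OF tendsto_const escapes_if_tendsto_boundary[OF emb x \<xi>]])
  have "- E + dist bp (x n) \<le> infdist bp (Z n)" for n
  proof -
    have "0 \<le> E" using E[of n] zero_le_dist order_trans by blast
    then have "dist bp (x n) \<le> dist bp z + E" if "z \<in> Z n" for z
      using that E[of n] dist_triangle[of bp "x n" "y n"]
      by (auto simp: Z_def dist_commute)
    then have "- E + dist bp (x n) \<le> (INF z\<in>Z n. dist bp z)"
      by (intro cINF_greatest) (auto simp: Z_def algebra_simps)
    then show ?thesis by (simp add: infdist_def Z_def)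
  qed
  then have "escaping bp Z"
    unfolding escaping_def by (intro filterlim_at_top_mono[OF far] always_eventually allI)
  then have "\<exists>s::nat \<Rightarrow> nat. strict_mono s \<and> (\<exists>\<xi>\<in>bdry emb. \<forall>y \<zeta>.
          (\<forall>n. y n \<in> cone bp (Z (s n))) \<and> (\<lambda>n. emb (y n)) \<longlonglongrightarrow> \<zeta> \<longrightarrow> \<zeta> \<in> R `` {\<xi>})"
    using E quasi_geodesic_pair contracting_pair unfolding Z_def
    by (intro cones[unfolded cones_converge_def, THEN spec[of _ E], THEN spec, THEN spec, THEN mp]) blast
  then obtain s :: "nat \<Rightarrow> nat" and \<theta> where s: "strict_mono s" and \<theta>: "\<And>u \<zeta>. (\<And>n. u n \<in> cone bp (Z (s n))) \<Longrightarrow>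
    (\<lambda>n. emb (u n)) \<longlonglongrightarrow> \<zeta> \<Longrightarrow> \<zeta> \<in> R `` {\<theta>}"
    by blast
  \<comment> \<open>A geodesic from \<open>bp\<close> to a point of Z n ends in Z n, so both
    sequences themselves run in the cones and share the class of \<theta>.\<close>
  have cone: "z \<in> cone bp (Z n)" if "z \<in> Z n" for z n
  proof -
    obtain S where "geodesic_segment bp z S" using geo by blast
    then show ?thesis using that geodesic_segment_ends(2) unfolding cone_def by blast
  qed
  have "\<xi> \<in> R `` {\<theta>}" "\<eta> \<in> R `` {\<theta>}"
    using \<theta>[of "x \<circ> s" \<xi>] \<theta>[of "y \<circ> s" \<eta>] cone LIMSEQ_subseq_LIMSEQ[OF x s] LIMSEQ_subseq_LIMSEQ[OF y s]
    by (auto simp: Z_def o_def)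
  then show ?thesis using R by (meson Image_singleton_iff equiv_def symD transD)
qed

text \<open>With displacement bounded on the orbit, an orbit sequence converging to \<eta> and its
  image under p have equivalent limits, so \<eta> and act p \<eta> are equivalent. A class inside
  the saturated limit set contains such an \<eta>; the inverse p' upgrades the inclusion of its
  image to equality.\<close>

lemma displaced_if_not_radical:
  fixes bp :: "'a::heine_borel"
  assumes geo: "\<And>x y :: 'a. \<exists>S. geodesic_segment x y S"
    and boundary: "convergence_boundary bp emb act R \<Gamma>"
    and p: "p \<in> isometries" "p \<notin> elliptic_radical bp emb act R \<Gamma>"
  shows "\<exists>v\<in>\<Gamma>. dist (v bp) (p (v bp)) > E"
proof (rule ccontr)
  assume "\<not> (\<exists>v\<in>\<Gamma>. dist (v bp) (p (v bp)) > E)"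
  then have E: "\<And>v. v \<in> \<Gamma> \<Longrightarrow> dist (v bp) (p (v bp)) \<le> E" by force
  have emb: "compactification emb" and act: "extends_action emb act" and R: "equiv (bdry emb) R"
    and cones: "cones_converge bp emb R"
    and R_act: "\<And>g \<xi> \<eta>. g \<in> isometries \<Longrightarrow> (\<xi>, \<eta>) \<in> R \<Longrightarrow> (act g \<xi>, act g \<eta>) \<in> R"
    using boundary by (auto simp: convergence_boundary_def)
  define p' where "p' = inv_into UNIV p"
  have p': "p' \<in> isometries" "\<And>\<xi>. act p (act p' \<xi>) = \<xi>" "\<And>\<xi>. act p' (act p \<xi>) = \<xi>"
    using isometries_inv[OF p(1)] act_inv[OF emb act p(1)] by (auto simp: p'_def)
  have sym: "(\<xi>, \<eta>) \<in> R \<Longrightarrow> (\<eta>, \<xi>) \<in> R" and trans: "(\<xi>, \<eta>) \<in> R \<Longrightarrow> (\<eta>, \<zeta>) \<in> R \<Longrightarrow> (\<xi>, \<zeta>) \<in> R" for \<xi> \<eta> \<zeta>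
    using R by (meson equiv_def symD transD)+
  have fixed: "(\<eta>, act p \<eta>) \<in> R" if \<eta>: "\<eta> \<in> limit_set emb {h bp |h. h \<in> \<Gamma>}" for \<eta>
  proof -
    obtain u where u: "\<And>n. u n \<in> emb ` {h bp |h. h \<in> \<Gamma>}" "u \<longlonglongrightarrow> \<eta>"
      using \<eta> by (auto simp: limit_set_def closure_sequential)
    have "\<forall>n. \<exists>h. h \<in> \<Gamma> \<and> u n = emb (h bp)" using u(1) by blast
    then obtain h where h: "\<And>n. h n \<in> \<Gamma>" "\<And>n. u n = emb (h n bp)" by metis
    have lim: "(\<lambda>n. emb (h n bp)) \<longlonglongrightarrow> \<eta>" using u(2) h(2) by (simp flip: h(2))
    have "(\<lambda>n. act p (emb (h n bp))) \<longlonglongrightarrow> act p \<eta>"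
      using continuous_on_tendsto_compose[OF act_continuous[OF act p(1)] lim] by simp
    then have "(\<lambda>n. emb (p (h n bp))) \<longlonglongrightarrow> act p \<eta>" by (simp add: act_emb[OF act p(1)])
    then show ?thesis
      using bounded_distance_same_class[OF geo emb cones R lim _ _ E[OF h(1)]] \<eta>
      by (simp add: limit_set_def)
  qed
  have "act p ` (R `` {\<xi>}) = R `` {\<xi>}"
    if \<xi>: "\<xi> \<in> bdry emb" "R `` {\<xi>} \<subseteq> R `` limit_set emb {h bp |h. h \<in> \<Gamma>}" for \<xi>
  proof -
    have "(\<xi>, \<xi>) \<in> R" using R \<xi>(1) by (meson equiv_def refl_onD)
    then obtain \<eta> where \<eta>: "\<eta> \<in> limit_set emb {h bp |h. h \<in> \<Gamma>}" "(\<eta>, \<xi>) \<in> R" using \<xi>(2) by blast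
    have pfix: "(\<xi>, act p \<xi>) \<in> R" using fixed[OF \<eta>(1)] \<eta>(2) R_act[OF p(1) \<eta>(2)] sym trans by blast
    have pfix': "(\<xi>, act p' \<xi>) \<in> R" using R_act[OF p'(1) pfix] sym by (simp add: p')
    have "act p \<zeta> \<in> R `` {\<xi>}" if "\<zeta> \<in> R `` {\<xi>}" for \<zeta>
      using that R_act[OF p(1)] pfix trans by blast
    moreover have "\<zeta> \<in> act p ` (R `` {\<xi>})" if "\<zeta> \<in> R `` {\<xi>}" for \<zeta>
    proof (rule image_eqI)
      show "\<zeta> = act p (act p' \<zeta>)" by (simp add: p')
      show "act p' \<zeta> \<in> R `` {\<xi>}" using that R_act[OF p'(1)] pfix' trans by blast
    qed
    ultimately show ?thesis by blast
  qed
  then show False using p by (simp add: elliptic_radical_def)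
qed

section \<open>The quasi-conformal density\<close>

lemma limsup_less_imp_bound:
  fixes d :: "nat \<Rightarrow> real"
  assumes "limsup (\<lambda>n. ereal (d n)) \<le> ereal \<epsilon>" "\<And>n. b \<le> d n"
  shows "b \<le> \<epsilon>"
proof -
  have "ereal b \<le> limsup (\<lambda>n. ereal (d n))" using assms(2) by (intro le_Limsup) auto
  then show ?thesis using assms(1) by (metis ereal_less_eq(3) order_trans)
qed

lemma tends_to_class_if_tendsto:
  assumes "equiv (bdry emb) R" "\<xi> \<in> bdry emb" "(\<lambda>n. emb (z n)) \<longlonglongrightarrow> \<xi>"
  shows "tends_to_class emb R z \<xi>"
proof -
  have "\<zeta> = \<xi>" if \<zeta>: "\<zeta> \<in> acc_points emb z" for \<zeta>
  proof -
    obtain s :: "nat \<Rightarrow> nat" where s: "strict_mono s" "(\<lambda>n. emb (z (s n))) \<longlonglongrightarrow> \<zeta>"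
      using \<zeta> unfolding acc_points_def by blast
    then show ?thesis using LIMSEQ_subseq_LIMSEQ[OF assms(3) s(1)] LIMSEQ_unique by (auto simp: o_def)
  qed
  moreover have "(\<xi>, \<xi>) \<in> R" using assms(1,2) by (meson equiv_def refl_onD)
  ultimately show ?thesis by (auto simp: tends_to_class_def)
qed

text \<open>A sequence converging to \<xi> has no other accumulation point, so it tends to the class
  of \<xi> and the limsup condition applies to it.\<close>

lemma busemann_limit:
  assumes B: "busemann_cocycles bp emb R Chor B \<epsilon>" and R: "equiv (bdry emb) R"
    and \<xi>: "\<xi> \<in> Chor" and lim: "(\<lambda>n. emb (z n)) \<longlonglongrightarrow> \<xi>"
    and low: "\<And>n. b \<le> \<bar>B \<xi> x y - (dist x (z n) - dist y (z n))\<bar>"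
  shows "b \<le> \<epsilon>"
proof (rule limsup_less_imp_bound[OF _ low])
  have "\<xi> \<in> nonpinched_points bp emb R" using B \<xi> unfolding busemann_cocycles_def by blast
  then have "\<xi> \<in> bdry emb" by (simp add: nonpinched_points_def)
  then have "tends_to_class emb R z \<xi>" using tends_to_class_if_tendsto[OF R _ lim] by blast
  then show "limsup (\<lambda>n. ereal \<bar>B \<xi> x y - (dist x (z n) - dist y (z n))\<bar>) \<le> ereal \<epsilon>"
    using B \<xi> by (simp add: busemann_cocycles_def)
qed

lemma busemann_lower:
  assumes emb: "compactification emb" and B: "busemann_cocycles bp emb R Chor B \<epsilon>"
    and R: "equiv (bdry emb) R" and \<xi>: "\<xi> \<in> Chor"
  shows "- (dist x y + \<epsilon>) \<le> B \<xi> x y"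
proof -
  have "\<xi> \<in> closure (range emb)" using compactification_dense[OF emb] by simp
  then obtain u where u: "\<And>n. u n \<in> range emb" "u \<longlonglongrightarrow> \<xi>" by (auto simp: closure_sequential)
  have "\<forall>n. \<exists>z. u n = emb z" using u(1) by blast
  then obtain z where z: "\<And>n. u n = emb (z n)" by metis
  have "- dist x y - B \<xi> x y \<le> \<epsilon>"
  proof (rule busemann_limit[OF B R \<xi>, of z])
    show "(\<lambda>n. emb (z n)) \<longlonglongrightarrow> \<xi>" using u(2) by (simp flip: z)
    show "- dist x y - B \<xi> x y \<le> \<bar>B \<xi> x y - (dist x (z n) - dist y (z n))\<bar>" for n
      using dist_triangle[of y "z n" x] by (simp add: dist_commute)
  qed
  then show ?thesis by simp
qed

text \<open>A geodesic from x to a point z of the cone passes within r of y, so dist x z - dist y z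
  \<ge> dist x y - 2 * r; the limit costs \<epsilon>.\<close>

lemma busemann_shadow:
  assumes B: "busemann_cocycles bp emb R Chor B \<epsilon>"
    and R: "equiv (bdry emb) R" and \<xi>: "\<xi> \<in> Chor" "\<xi> \<in> shadow emb x y r"
  shows "dist x y - 2 * r - \<epsilon> \<le> B \<xi> x y"
proof -
  obtain u where u: "\<And>n. u n \<in> emb ` cone x (ball y r)" "u \<longlonglongrightarrow> \<xi>"
    using \<xi>(2) by (auto simp: shadow_def limit_set_def closure_sequential)
  then have "\<forall>n. \<exists>z. z \<in> cone x (ball y r) \<and> u n = emb z" by blast
  then obtain z where z: "\<And>n. z n \<in> cone x (ball y r)" "\<And>n. u n = emb (z n)" by metis
  have "dist x y - 2 * r - B \<xi> x y \<le> \<epsilon>"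
  proof (rule busemann_limit[OF B R \<xi>(1), of z])
    show "(\<lambda>n. emb (z n)) \<longlonglongrightarrow> \<xi>" using u(2) by (simp flip: z(2))
    fix n
    obtain S m where S: "geodesic_segment x (z n) S" "m \<in> S" "dist y m < r"
      using z(1)[of n] by (auto simp: cone_def)
    have "dist x y - 2 * r \<le> dist x (z n) - dist y (z n)"
      using geodesic_segment_dist[OF S(1,2)] S(3) dist_triangle[of x y m] dist_triangle[of y "z n" m]
      by (simp add: dist_commute)
    then show "dist x y - 2 * r - B \<xi> x y \<le> \<bar>B \<xi> x y - (dist x (z n) - dist y (z n))\<bar>" by linarith
  qed
  then show ?thesis by simp
qed

lemma measure_le_if_RN_deriv_le:
  assumes fin: "finite_measure M" "finite_measure N" and sets: "sets N = sets M"
    and ac: "absolutely_continuous M N" and S: "S \<in> sets M"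
    and le: "AE \<xi> in M. \<xi> \<in> S \<longrightarrow> RN_deriv M N \<xi> \<le> ennreal c" and c: "c \<ge> 0"
  shows "measure N S \<le> c * measure M S"
proof -
  interpret M: finite_measure M by fact
  interpret N: finite_measure N by fact
  have "emeasure N S = emeasure (density M (RN_deriv M N)) S"
    by (simp add: M.density_RN_deriv[OF ac sets])
  also have "\<dots> = (\<integral>\<^sup>+\<xi>. RN_deriv M N \<xi> * indicator S \<xi> \<partial>M)"
    using S by (simp add: emeasure_density)
  also have "\<dots> \<le> (\<integral>\<^sup>+\<xi>. ennreal c * indicator S \<xi> \<partial>M)"
    using le by (intro nn_integral_mono_AE) (auto simp: indicator_def elim!: eventually_mono)
  also have "\<dots> = ennreal c * emeasure M S" using S by (simp add: nn_integral_cmult_indicator)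
  finally have "ennreal (measure N S) \<le> ennreal (c * measure M S)"
    using c by (simp add: N.emeasure_eq_measure M.emeasure_eq_measure ennreal_mult)
  then show ?thesis using c by (simp add: ennreal_le_iff)
qed

lemma shadow_borel:
  assumes "compactification emb"
  shows "shadow emb x y r \<in> sets borel"
proof -
  have "closed (bdry emb)" using compactification_open[OF assms] by (simp add: bdry_def closed_Compl)
  then show ?thesis unfolding shadow_def limit_set_def by (intro borel_closed closed_Int) auto
qed

section \<open>Comparing masses seen from different points\<close>

context
  fixes bp :: "'a::heine_borel" and emb :: "'a \<Rightarrow> 'b::metric_space" and act R H Chor B \<epsilon> \<omega> L \<mu>
  assumes emb: "compactification emb" and act: "extends_action emb act" and R: "equiv (bdry emb) R"
    and B: "busemann_cocycles bp emb R Chor B \<epsilon>"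
    and dens: "qc_density bp emb act H Chor B \<omega> L \<mu>"
    and null: "\<And>x. emeasure (\<mu> x) (- bdry emb) = 0"
    and \<omega>: "\<omega> \<ge> 0" and L: "L \<ge> 1"
begin

lemma density_finite: "finite_measure (\<mu> x)" and density_sets: "sets (\<mu> x) = sets borel"
  using dens by (auto simp: qc_density_def)

lemma density_measure_le:
  assumes S: "S \<in> sets borel" and b: "\<And>\<xi>. \<xi> \<in> Chor \<Longrightarrow> \<xi> \<in> S \<Longrightarrow> b \<le> B \<xi> x y"
  shows "measure (\<mu> x) S \<le> L * exp (- \<omega> * b) * measure (\<mu> y) S"
proof (rule measure_le_if_RN_deriv_le)
  show "absolutely_continuous (\<mu> y) (\<mu> x)" using dens by (simp add: qc_density_def)
  have "AE \<xi> in \<mu> y. \<xi> \<in> Chor \<and> RN_deriv (\<mu> y) (\<mu> x) \<xi>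
      \<in> {ennreal (1 / L * exp (- \<omega> * B \<xi> x y))..ennreal (L * exp (- \<omega> * B \<xi> x y))}"
    using dens unfolding qc_density_def by blast
  then show "AE \<xi> in \<mu> y. \<xi> \<in> S \<longrightarrow> RN_deriv (\<mu> y) (\<mu> x) \<xi> \<le> ennreal (L * exp (- \<omega> * b))"
  proof (rule eventually_mono, intro impI)
    fix \<xi> assume *: "\<xi> \<in> Chor \<and> RN_deriv (\<mu> y) (\<mu> x) \<xi>
      \<in> {ennreal (1 / L * exp (- \<omega> * B \<xi> x y))..ennreal (L * exp (- \<omega> * B \<xi> x y))}" "\<xi> \<in> S"
    then have "\<omega> * b \<le> \<omega> * B \<xi> x y" using b \<omega> by (intro mult_left_mono) auto
    then have "L * exp (- \<omega> * B \<xi> x y) \<le> L * exp (- \<omega> * b)" using L by (intro mult_left_mono) auto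
    moreover have "RN_deriv (\<mu> y) (\<mu> x) \<xi> \<le> ennreal (L * exp (- \<omega> * B \<xi> x y))" using * by simp
    ultimately show "RN_deriv (\<mu> y) (\<mu> x) \<xi> \<le> ennreal (L * exp (- \<omega> * b))"
      using ennreal_leI order_trans by blast
  qed
qed (use L S density_finite density_sets in auto)

text \<open>A lower bound on the cocycle bounds the derivative from above; exchanging x and y gives
  the reverse comparison.\<close>

lemma density_change_of_point:
  assumes "S \<in> sets borel"
  shows "measure (\<mu> x) S \<le> L * exp (\<omega> * (dist x y + \<epsilon>)) * measure (\<mu> y) S"
  using density_measure_le[OF assms, of "- (dist x y + \<epsilon>)" x y] busemann_lower[OF emb B R, of _ x y]
  by (simp add: algebra_simps)

lemma density_shadow:
  "measure (\<mu> x) (shadow emb x y r) \<le> L * exp (- \<omega> * (dist x y - 2 * r - \<epsilon>)) * measure (\<mu> y) (shadow emb x y r)"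
  by (rule density_measure_le[OF shadow_borel[OF emb]]) (rule busemann_shadow[OF B R])

text \<open>Zero mass at y would force zero mass at \<open>bp\<close>, against the
  normalization.\<close>

lemma density_positive: "measure (\<mu> y) UNIV > 0"
proof (rule ccontr)
  assume "\<not> measure (\<mu> y) UNIV > 0"
  then have "measure (\<mu> y) UNIV = 0" using measure_nonneg[of "\<mu> y" UNIV] by linarith
  then show False
    using density_change_of_point[of UNIV bp y] dens by (simp add: qc_density_def)
qed

lemma density_equivariant:
  assumes h: "h \<in> H" "h \<in> isometries" and U: "open U"
  shows "measure (\<mu> x) U \<le> L * measure (\<mu> (h x)) (act h ` U)"
proof -
  have hU: "act h ` U \<in> sets borel" using act_open[OF act h(2) U] by simp
  have meas: "act h \<in> \<mu> x \<rightarrow>\<^sub>M borel"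
    using borel_measurable_continuous_onI[OF act_continuous[OF act h(2)]]
    by (simp cong: measurable_cong_sets add: measurable_cong_sets[OF density_sets refl])
  have sp: "space (\<mu> x) = UNIV" using sets_eq_imp_space_eq[OF density_sets] by simp
  have "measure (\<mu> x) U = measure (distr (\<mu> x) borel (act h)) (act h ` U)"
    using measure_distr[OF meas hU] act_inj[OF act h(2)] by (simp add: sp inj_vimage_image_eq)
  also have "\<dots> \<le> L * measure (\<mu> (h x)) (act h ` U)"
  proof (rule measure_le_if_RN_deriv_le[OF density_finite])
    show "finite_measure (distr (\<mu> x) borel (act h))"
      by (rule finite_measure.finite_measure_distr[OF density_finite meas])
    show "absolutely_continuous (\<mu> (h x)) (distr (\<mu> x) borel (act h))"
      using dens h(1) by (simp add: qc_density_def)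
    have "AE \<xi> in \<mu> (h x). RN_deriv (\<mu> (h x)) (distr (\<mu> x) borel (act h)) \<xi> \<in> {ennreal (1 / L)..ennreal L}"
      using dens h(1) unfolding qc_density_def by blast
    then show "AE \<xi> in \<mu> (h x). \<xi> \<in> act h ` U \<longrightarrow>
        RN_deriv (\<mu> (h x)) (distr (\<mu> x) borel (act h)) \<xi> \<le> ennreal L"
      by (rule eventually_mono) simp
  qed (use L hU density_sets in auto)
  finally show ?thesis .
qed

text \<open>\<open>X\<close> is open and dense, so the open complements \<open>U\<close> of the closed cone and \<open>h U\<close> are
  disjoint as soon as their traces on \<open>X\<close> are.\<close>

lemma density_shadow_lower:
  assumes h: "h \<in> H" "h \<in> isometries" and K: "dist y (h y) \<le> K"
    and disp: "\<And>w. w \<notin> cone x (ball y r) \<Longrightarrow> h w \<in> cone x (ball y r)"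
  shows "measure (\<mu> y) UNIV \<le> (1 + L * (L * exp (\<omega> * (K + \<epsilon>)))) * measure (\<mu> y) (shadow emb x y r)"
proof -
  define Sh where "Sh = shadow emb x y r"
  define U where "U = - closure (emb ` cone x (ball y r))"
  interpret finite_measure "\<mu> y" by (rule density_finite)
  have U: "open U" by (simp add: U_def open_Compl)
  have hU: "open (act h ` U)" by (rule act_open[OF act h(2) U])
  have "U \<inter> act h ` U = {}"
  proof (rule ccontr)
    assume "U \<inter> act h ` U \<noteq> {}"
    then have "U \<inter> act h ` U \<inter> closure (range emb) \<noteq> {}"
      using compactification_dense[OF emb] by simp
    then have "U \<inter> act h ` U \<inter> range emb \<noteq> {}"
      using open_Int_closure_eq_empty[OF open_Int[OF U hU]] by blast
    then obtain w u where wu: "emb w \<in> U" "u \<in> U" "emb w = act h u" by auto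
    have w: "h (inv_into UNIV h w) = w" by (rule isometriesD(5)[OF h(2)])
    have "act h u = act h (emb (inv_into UNIV h w))"
      using wu(3) act_emb[OF act h(2), of "inv_into UNIV h w"] w by simp
    then have "emb (inv_into UNIV h w) \<in> U" using act_inj[OF act h(2)] wu(2) by (simp add: inj_eq)
    moreover have "z \<notin> cone x (ball y r)" if "emb z \<in> U" for z
      using that closure_subset[of "emb ` cone x (ball y r)"] by (auto simp: U_def)
    ultimately show False using disp[of "inv_into UNIV h w"] w wu(1) by metis
  qed
  \<comment> \<open>Within the boundary the complement of U is the shadow; the rest of the
    compactification is a null set.\<close>
  then have sub: "UNIV \<subseteq> U \<union> Sh \<union> - bdry emb" "act h ` U \<subseteq> Sh \<union> - bdry emb"
    by (auto simp: U_def Sh_def shadow_def limit_set_def)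
  have sets: "U \<in> sets (\<mu> y)" "act h ` U \<in> sets (\<mu> y)" "Sh \<in> sets (\<mu> y)" "- bdry emb \<in> sets (\<mu> y)"
    using U hU shadow_borel[OF emb] compactification_open[OF emb]
    by (auto simp: density_sets Sh_def bdry_def)
  have null_y: "measure (\<mu> y) (- bdry emb) = 0" using null[of y] by (simp add: measure_def)
  have 1: "measure (\<mu> y) UNIV \<le> measure (\<mu> y) U + measure (\<mu> y) Sh"
  proof -
    have "measure (\<mu> y) UNIV \<le> measure (\<mu> y) (U \<union> Sh \<union> - bdry emb)"
      using sub(1) sets by (intro finite_measure_mono) auto
    also have "\<dots> \<le> measure (\<mu> y) (U \<union> Sh) + measure (\<mu> y) (- bdry emb)"
      using sets by (intro measure_Un_le) auto
    also have "\<dots> \<le> measure (\<mu> y) U + measure (\<mu> y) Sh"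
      using sets measure_Un_le[of U "\<mu> y" Sh] null_y by auto
    finally show ?thesis .
  qed
  have 2: "measure (\<mu> y) (act h ` U) \<le> measure (\<mu> y) Sh"
  proof -
    have "measure (\<mu> y) (act h ` U) \<le> measure (\<mu> y) (Sh \<union> - bdry emb)"
      using sub(2) sets by (intro finite_measure_mono) auto
    also have "\<dots> \<le> measure (\<mu> y) Sh + measure (\<mu> y) (- bdry emb)"
      using sets by (intro measure_Un_le) auto
    finally show ?thesis using null_y by simp
  qed
  \<comment> \<open>Equivariance carries the mass of U to h y at the cost L, and returning to y
    costs L * exp (\<omega> * (K + \<epsilon>)).\<close>
  have "measure (\<mu> y) U \<le> L * measure (\<mu> (h y)) (act h ` U)"
    by (rule density_equivariant[OF h U])
  also have "\<dots> \<le> L * (L * exp (\<omega> * (dist (h y) y + \<epsilon>)) * measure (\<mu> y) (act h ` U))"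
    using L hU by (intro mult_left_mono density_change_of_point) auto
  also have "\<dots> \<le> L * (L * exp (\<omega> * (K + \<epsilon>)) * measure (\<mu> y) Sh)"
    using L K \<omega> 2 by (intro mult_left_mono mult_mono) (auto simp: dist_commute mult_left_mono)
  finally show ?thesis using 1 by (simp add: Sh_def algebra_simps)
qed

end

lemma growth_rate_nonneg:
  assumes "growth_rate bp H = ereal \<omega>"
  shows "\<omega> \<ge> 0"
proof -
  \<comment> \<open>The convention ln 0 = 0 covers the cardinality 0 that \<open>card\<close>
    assigns to an infinite set.\<close>
  have ln: "0 \<le> ln (real n)" for n by (cases "n = 0") auto
  have "0 \<le> growth_rate bp H"
    unfolding growth_rate_def by (intro le_Limsup always_eventually allI) (simp_all add: ln)
  then show ?thesis using assms by simp
qed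

theorem lemma1p23:
  fixes bp :: "'a::heine_borel"
    and emb :: "'a \<Rightarrow> 'b::metric_space"
    and act :: "('a \<Rightarrow> 'a) \<Rightarrow> 'b \<Rightarrow> 'b"
    and R :: "('b \<times> 'b) set"
    and \<Gamma> H P :: "('a \<Rightarrow> 'a) set"
    and \<omega> :: real
  assumes geodesic: "\<And>x y :: 'a. \<exists>S. geodesic_segment x y S"
    and boundary: "convergence_boundary bp emb act R \<Gamma>"
    and Gamma: "subgroup \<Gamma> isom_group" "discrete \<Gamma>"
      "\<not> elementary_group (isom_group\<lparr>carrier := \<Gamma>\<rparr>)"
      "\<exists>f\<in>\<Gamma>. nonpinched_contracting bp emb R f"
      "divergence_type bp \<Gamma>"
    and H: "subgroup H isom_group" "discrete H"
    and confined: "confining_subset \<Gamma> H P" "P \<inter> elliptic_radical bp emb act R \<Gamma> \<subseteq> {id}"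
    and omega: "growth_rate bp H = ereal \<omega>"
  shows "\<exists>C2 :: real \<Rightarrow> real \<Rightarrow> real \<Rightarrow> real. (\<forall>L \<epsilon> r. C2 L \<epsilon> r > 0) \<and>
    (\<forall>Chor B \<epsilon>. busemann_cocycles bp emb R Chor B \<epsilon> \<longrightarrow>
      (\<exists>C1 :: real \<Rightarrow> real. (\<forall>L. C1 L > 0) \<and>
        (\<forall>L\<ge>1. \<forall>\<mu>. qc_density bp emb act H Chor B \<omega> L \<mu> \<and>
            (\<forall>x. emeasure (\<mu> x) (- bdry emb) = 0) \<longrightarrow>
          (\<exists>r0>0. \<forall>x\<in>{g bp |g. g \<in> \<Gamma>}. \<forall>y\<in>{g bp |g. g \<in> \<Gamma>}. \<forall>r\<ge>r0.
            measure (\<mu> y) UNIV * exp (- \<omega> * dist x y) < C1 L * measure (\<mu> x) (shadow emb x y r) \<and>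
            measure (\<mu> x) (shadow emb x y r)
              < C2 L \<epsilon> r * (measure (\<mu> y) UNIV * exp (- \<omega> * dist x y))))))"
proof -
  have \<omega>: "\<omega> \<ge> 0" by (rule growth_rate_nonneg[OF omega])
  have emb: "compactification emb" and act: "extends_action emb act" and R: "equiv (bdry emb) R"
    using boundary by (auto simp: convergence_boundary_def)
  obtain f where f: "f \<in> \<Gamma>" "contracting_isometry bp f"
    using Gamma(4) by (auto simp: nonpinched_contracting_def)
  obtain C c where ax: "axis bp \<Gamma> (\<lambda>n. f [^]\<^bsub>isom_group\<^esub> n) C c"
    using axis_of_contracting_isometry[OF geodesic Gamma(1,2) f] by blast
  obtain h0 where h0: "h0 \<in> \<Gamma>" "\<forall>(n::int) (m::int). n \<noteq> 0 \<longrightarrow> m \<noteq> 0 \<longrightarrow>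
      h0 \<circ> f [^]\<^bsub>isom_group\<^esub> n \<noteq> f [^]\<^bsub>isom_group\<^esub> m \<circ> h0"
    using axis.not_commensurating[OF ax Gamma(1,3)] by (elim bexE)
  have P: "finite (P - {id})" "P - {id} \<subseteq> isometries"
    using confined(1) by (auto simp: confining_subset_def)
  have moved: "\<exists>v\<in>\<Gamma>. dist (v bp) (p (v bp)) > E" if "p \<in> P - {id}" for p E
    using displaced_if_not_radical[OF geodesic boundary] P(2) confined(2) that by blast
  have conf: "\<exists>h\<in>H. \<exists>p\<in>P - {id}. \<forall>x. h (g x) = g (p x)" if g: "g \<in> \<Gamma>" for g
  proof -
    have gi: "g \<in> isometries" using isom_subgroupD(1)[OF Gamma(1)] g by blast
    obtain h where h: "h \<in> H" "inv\<^bsub>isom_group\<^esub> g \<circ> h \<circ> g \<in> P - {id}"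
      using confined(1) g by (auto simp: confining_subset_def)
    have "h (g x) = g ((inv\<^bsub>isom_group\<^esub> g \<circ> h \<circ> g) x)" for x
      by (simp add: m_inv_isom_group[OF gi] isometriesD(5)[OF gi])
    then show ?thesis using h by blast
  qed
  have Hi: "H \<subseteq> isometries" by (rule isom_subgroupD(1)[OF H(1)])
  \<comment> \<open>Both come from the geometry alone, so the radius serves every density.\<close>
  obtain K r0 where r0: "r0 > 0" and K: "\<And>g x r. g \<in> \<Gamma> \<Longrightarrow> r \<ge> r0 \<Longrightarrow>
    \<exists>h\<in>H. dist (g bp) (h (g bp)) \<le> K \<and>
       (\<forall>w. w \<notin> cone x (ball (g bp) r) \<longrightarrow> h w \<in> cone x (ball (g bp) r))"
    by (rule axis.shadow_complement_displaced[OF ax h0(1) h0(2)[rule_format] P moved Hi finite_discrete_isometries[OF H] conf])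
      (assumption+, rule that)
  \<comment> \<open>2 * r + \<epsilon> is the loss in \<open>busemann_shadow\<close>; the summand 1
    gives strictness, and the absolute value gives positivity at every real L.\<close>
  define C2 where "C2 L \<epsilon> r = (\<bar>L\<bar> + 1) * exp (\<omega> * (2 * r + \<epsilon>))" for L \<epsilon> r :: real
  \<comment> \<open>The factors come from \<open>density_shadow_lower\<close> and from the change
    from y to x; the summand 1 makes the inequality strict.\<close>
  define C1 where "C1 \<epsilon> L = (1 + L * (L * exp (\<omega> * (K + \<epsilon>)))) * (\<bar>L\<bar> * exp (\<omega> * \<epsilon>)) + 1" for \<epsilon> L :: real
  have "measure (\<mu> y) UNIV * exp (- \<omega> * dist x y) < C1 \<epsilon> L * measure (\<mu> x) (shadow emb x y r) \<and>
      measure (\<mu> x) (shadow emb x y r) < C2 L \<epsilon> r * (measure (\<mu> y) UNIV * exp (- \<omega> * dist x y))"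
    if B: "busemann_cocycles bp emb R Chor B \<epsilon>" and L: "L \<ge> 1"
      and dens: "qc_density bp emb act H Chor B \<omega> L \<mu>"
      and null: "\<And>x. emeasure (\<mu> x) (- bdry emb) = 0"
      and y: "y \<in> {g bp |g. g \<in> \<Gamma>}" and r: "r \<ge> r0" for Chor B \<epsilon> L \<mu> x y r
  proof -
    define Sh where "Sh = shadow emb x y r"
    note ctx = emb act R B dens null \<omega> L
    obtain g where g: "g \<in> \<Gamma>" "y = g bp" using y by blast
    obtain h where h: "h \<in> H" "dist y (h y) \<le> K"
      "\<And>w. w \<notin> cone x (ball y r) \<Longrightarrow> h w \<in> cone x (ball y r)"
      using K[OF g(1) r, of x] g(2) by blast
    have hi: "h \<in> isometries" using h(1) Hi by blast
    have pos: "measure (\<mu> y) UNIV > 0" by (rule density_positive[OF ctx])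
    have "measure (\<mu> y) UNIV \<le> (1 + L * (L * exp (\<omega> * (K + \<epsilon>)))) * measure (\<mu> y) Sh"
      unfolding Sh_def by (rule density_shadow_lower[OF ctx h(1) hi h(2,3)])
    also have "\<dots> \<le> (1 + L * (L * exp (\<omega> * (K + \<epsilon>)))) * (L * exp (\<omega> * (dist y x + \<epsilon>)) * measure (\<mu> x) Sh)"
      unfolding Sh_def using L
      by (intro mult_left_mono density_change_of_point[OF ctx shadow_borel[OF emb]]) auto
    also have "\<dots> = (C1 \<epsilon> L - 1) * exp (\<omega> * dist x y) * measure (\<mu> x) Sh"
      using L by (simp add: C1_def exp_add distrib_left dist_commute mult_ac)
    finally have "measure (\<mu> y) UNIV * exp (- \<omega> * dist x y)
        \<le> (C1 \<epsilon> L - 1) * exp (\<omega> * dist x y) * measure (\<mu> x) Sh * exp (- \<omega> * dist x y)"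
      by (intro mult_right_mono) auto
    also have "\<dots> = (C1 \<epsilon> L - 1) * measure (\<mu> x) Sh" by (simp add: exp_minus)
    finally have lower: "measure (\<mu> y) UNIV * exp (- \<omega> * dist x y) \<le> (C1 \<epsilon> L - 1) * measure (\<mu> x) Sh" .
    moreover have "measure (\<mu> y) UNIV * exp (- \<omega> * dist x y) > 0" using pos by simp
    \<comment> \<open>The summand 1 of \<open>C1\<close> gains something only on a shadow of
      positive mass.\<close>
    ultimately have "measure (\<mu> x) Sh \<noteq> 0" by (metis mult_zero_right not_le)
    then have "measure (\<mu> x) Sh > 0" using measure_nonneg[of "\<mu> x" Sh] by linarith
    then have 1: "measure (\<mu> y) UNIV * exp (- \<omega> * dist x y) < C1 \<epsilon> L * measure (\<mu> x) Sh"
      using lower by (simp add: algebra_simps)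
    interpret finite_measure "\<mu> y" by (rule density_finite[OF ctx])
    have "space (\<mu> y) = UNIV" using sets_eq_imp_space_eq[OF density_sets[OF ctx]] by simp
    then have "measure (\<mu> y) Sh \<le> measure (\<mu> y) UNIV" using bounded_measure[of Sh] by simp
    then have "measure (\<mu> x) Sh \<le> L * exp (- \<omega> * (dist x y - 2 * r - \<epsilon>)) * measure (\<mu> y) UNIV"
      using density_shadow[OF ctx, of x y r] L unfolding Sh_def
      by (meson exp_ge_zero mult_left_mono mult_nonneg_nonneg order_trans zero_le_one)
    also have "\<dots> < (L + 1) * exp (- \<omega> * (dist x y - 2 * r - \<epsilon>)) * measure (\<mu> y) UNIV"
      using pos by (intro mult_strict_right_mono) auto
    also have "\<dots> = C2 L \<epsilon> r * (measure (\<mu> y) UNIV * exp (- \<omega> * dist x y))"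
    proof -
      have "exp (- \<omega> * (dist x y - 2 * r - \<epsilon>)) = exp (\<omega> * (2 * r + \<epsilon>)) * exp (- \<omega> * dist x y)"
        by (simp add: algebra_simps flip: exp_add)
      then show ?thesis using L by (simp add: C2_def mult_ac)
    qed
    finally show ?thesis using 1 by (simp add: Sh_def)
  qed
  note main = this
  have C1: "C1 \<epsilon> L > 0" for \<epsilon> L
    unfolding C1_def using zero_le_square[of L] by (simp add: add_nonneg_pos mult.assoc[symmetric])
  have C2: "C2 L \<epsilon> r > 0" for L \<epsilon> r by (simp add: C2_def)
  show ?thesis
  proof (intro exI[of _ C2] conjI allI impI)
    fix Chor B and \<epsilon> :: real assume "busemann_cocycles bp emb R Chor B \<epsilon>"
    then show "\<exists>C1 :: real \<Rightarrow> real. (\<forall>L. C1 L > 0) \<and>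
        (\<forall>L\<ge>1. \<forall>\<mu>. qc_density bp emb act H Chor B \<omega> L \<mu> \<and>
            (\<forall>x. emeasure (\<mu> x) (- bdry emb) = 0) \<longrightarrow>
          (\<exists>r0>0. \<forall>x\<in>{g bp |g. g \<in> \<Gamma>}. \<forall>y\<in>{g bp |g. g \<in> \<Gamma>}. \<forall>r\<ge>r0.
            measure (\<mu> y) UNIV * exp (- \<omega> * dist x y) < C1 L * measure (\<mu> x) (shadow emb x y r) \<and>
            measure (\<mu> x) (shadow emb x y r)
              < C2 L \<epsilon> r * (measure (\<mu> y) UNIV * exp (- \<omega> * dist x y))))"
      using C1 main r0 by (intro exI[of _ "C1 \<epsilon>"] conjI allI impI exI[of _ r0] ballI) blast+
  qed (rule C2)
qed

end
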